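(* Let $\mathcal H=\mathbb C^2$ with standard basis $\{|0\rangle,|1\rangle\}$, let $\{|\eta_0^A\rangle,|\eta_1^A\rangle\}$ and $\{|\eta_0^B\rangle,|\eta_1^B\rangle\}$ be orthonormal bases of $\mathcal H$, and let $\mathsf A,\mathsf A'$ and $\mathsf B,\mathsf B'$ be the corresponding pairs of maximally incompatible channel measurements for Alice and Bob. Let $\Phi$ be a qubit PR-channel which implements the PR-box with these measurements, and let $C\in B(\mathcal H_{out}\otimes\mathcal H_{in})$ be its Choi matrix, where $\mathcal H_{out}=\mathcal H_{in}=\mathcal H\otimes\mathcal H$. Then there are isometries $U_\alpha:\mathbb C^2\to\mathcal H_{out}$, $\alpha\in\{0,1\}^2$, and a decomposition $\{0,1\}^2=\Delta_0\cup\Delta_1$ into disjoint subsets, such that $U_\alpha=U_\beta=:V_{out}$ for all $\alpha,\beta\in\Delta_1$ and $C$ has the form $$C=(V_{out}\otimes V_{in})B_r(V_{out}^*\otimes V_{in}^* )+\frac12\sum_{\alpha\in\Delta_0}U_\alpha B_{\mathrm{diag}}(z_\alpha)U_\alpha^*\otimes|\alpha\rangle\langle\alpha|,$$ where $z_\alpha\in\mathbb C$, $|z_\alpha|\le1$, $r=|\Delta_1|$, $B_r$ is a matrix of the form $$B_r=\frac12\Big(\sum_{p=1}^rB_{\mathrm{diag}}(z_p)\otimes|p\rangle\langle p|+\sum_{p\neq q}B_{\mathrm{off}}(x_{p,q},y_{p,q})\otimes|p\rangle\langle q|\Big)\in B(\mathbb C^2\otimes\mathbb C^r)$$ for some $z_p,x_{p,q},y_{p,q}\in\mathbb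 C$ ($p,q=1,\dots,r$), and $V_{in}:\mathbb C^r\to\mathcal H_{in}$ is an isometry with $V_{in}|p\rangle=|\alpha_p\rangle$, $p=1,\dots,r$, where $\Delta_1=\{\alpha_1,\dots,\alpha_r\}$.
   Context: **Notation.** For $x,y,z\in\mathbb C$: $B_{\mathrm{diag}}(z)=\begin{pmatrix} 1 & z \\ \bar z & 1 \end{pmatrix}$ and $B_{\mathrm{off}}(x,y)=\begin{pmatrix} 0 & x \\ y & 0 \end{pmatrix}$. $\{|p\rangle\}_{p=1}^r$ is the standard basis of $\mathbb C^r$. For $\alpha=km\in\{0,1\}^2$, $|\alpha\rangle=|k\rangle\otimes|m\rangle$. **Channels.** A channel is a completely positive trace preserving linear map. A bipartite qubit channel $\Phi:B(\mathcal H\otimes\mathcal H)\to B(\mathcal H\otimes\mathcal H)$ has input space $\mathcal H_{in}=\mathcal H_{A,in}\otimes\mathcal H_{B,in}$ and output space $\mathcal H_{out}=\mathcal H_{A,out}\otimes\mathcal H_{B,out}$ (copies of $\mathcal H$; first factors Alice's, second Bob's). Its Choi matrix is $C=\sum_{\alpha,\beta\in\{0,1\}^2}\Phi(|\alpha\rangle\langle\beta|)\otimes|\alpha\rangle\langle\beta|\in B(\mathcal H_{out}\otimes\mathcal H_{in})$. $\Phi$ is non-signaling if $\mathrm{Tr}_{A,out}(C)=\mathbb 1_{A,in}\otimes C_B$ and $\mathrm{Tr}_{B,out}(C)=\mathbb 1_{B,in}\otimes C_A$ for some positive operators $C_B$ on $\mathcal H_{B,out}\otimes\mathcal H_{B,in}$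 and $C_A$ on $\mathcal H_{A,out}\otimes\mathcal H_{A,in}$. **Measurements.** The maximally incompatible pair $\mathsf A,\mathsf A'$ of two-outcome measurements on qubit channels corresponding to the basis $\{|\eta^A_i\rangle\}$ is: for $\mathsf A$, input $|0\rangle$ into the channel and measure the output in the basis $\{|0\rangle,|1\rangle\}$; for $\mathsf A'$, input $|1\rangle$ and measure the output in the basis $\{|\eta^A_0\rangle,|\eta_1^A\rangle\}$; in both cases the outcome is $1$ for the basis vector with index $0$ and $-1$ for the vector with index $1$. (In terms of operators on output$\otimes$input: $F_{\mathsf A}=|00\rangle\langle00|$, $F_{\mathsf A}^\perp=|10\rangle\langle10|$, $F_{\mathsf A'}=|\eta^A_0\rangle\langle\eta^A_0|\otimes|1\rangle\langle1|$, $F_{\mathsf A'}^\perp=|\eta^A_1\rangle\langle\eta^A_1|\otimes|1\rangle\langle1|$.) The pair $\mathsf B,\mathsf B'$ is defined in the same way on Bob's side from $\{|\eta^B_i\rangle\}$. For a bipartite channel $\Phi$, $P_\Phi(\epsilon,\eta|\mathsf C,\mathsf D)$ denotes the joint probability of outcome $\epsilon$ for Alice's measurement $\mathsf C\in\{\mathsf A,\mathsf A'\}$ and $\eta$ for Bob's measurement $\mathsf D\in\{\mathsf B,\mathsf B'\}$, i.e. the probability obtained by inputting the product of the two corresponding input states into $\Phi$ and measuring the product of the corresponding bases on the output. **PR-channel.** $\Phi$ is a PR-channel implementing the PR-box with $\mathsf A,\mathsf A',\mathsf B,\mathsf B'$ if $\Phi$ is non-signaling and for all $\mathsf C,\mathsf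 D$ and $\epsilon,\eta\in\{1,-1\}$: $P_\Phi(\epsilon,\eta|\mathsf C,\mathsf D)=\frac12$ if [$(\mathsf C,\mathsf D)\neq(\mathsf A',\mathsf B')$ and $\epsilon\eta=1$] or [$(\mathsf C,\mathsf D)=(\mathsf A',\mathsf B')$ and $\epsilon\eta=-1$], and $P_\Phi(\epsilon,\eta|\mathsf C,\mathsf D)=0$ otherwise. *)

theory Defs
  imports "Jordan_Normal_Form.Schur_Decomposition"
begin

text \<open>Operators are complex matrices. A tensor product \<open>\<complex>\<^sup>m \<otimes> \<complex>\<^sup>n\<close> is identified with
  \<open>\<complex>\<^sup>m\<^sup>n\<close> by giving \<open>|i\<rangle> \<otimes> |j\<rangle>\<close> the index \<open>i * n + j\<close>.\<close>

section \<open>Matrices and tensor products\<close>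

definition msum :: "nat \<Rightarrow> nat \<Rightarrow> ('a \<Rightarrow> complex mat) \<Rightarrow> 'a set \<Rightarrow> complex mat" where
  "msum m n f S = mat m n (\<lambda>ij. \<Sum>s\<in>S. f s $$ ij)"

definition mtrace :: "complex mat \<Rightarrow> complex" where
  "mtrace X = (\<Sum>i<dim_row X. X $$ (i, i))"

definition outer :: "complex vec \<Rightarrow> complex vec \<Rightarrow> complex mat" where
  "outer v w = mat (dim_vec v) (dim_vec w) (\<lambda>(i, j). v $ i * cnj (w $ j))"

definition kron_vec :: "complex vec \<Rightarrow> complex vec \<Rightarrow> complex vec" where
  "kron_vec v w = vec (dim_vec v * dim_vec w)
     (\<lambda>i. v $ (i div dim_vec w) * w $ (i mod dim_vec w))"

definition kron :: "complex mat \<Rightarrow> complex mat \<Rightarrow> complex mat" where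
  "kron X Y = mat (dim_row X * dim_row Y) (dim_col X * dim_col Y)
     (\<lambda>(i, j). X $$ (i div dim_row Y, j div dim_col Y) * Y $$ (i mod dim_row Y, j mod dim_col Y))"

definition isometry_mat :: "nat \<Rightarrow> nat \<Rightarrow> complex mat \<Rightarrow> bool" where
  "isometry_mat n m V \<longleftrightarrow> V \<in> carrier_mat m n \<and> mat_adjoint V * V = 1\<^sub>m n"

text \<open>The order on \<^typ>\<open>complex\<close> makes \<open>0 \<le> z\<close> mean that \<open>z\<close> is real and nonnegative.\<close>

definition positive_mat :: "nat \<Rightarrow> complex mat \<Rightarrow> bool" where
  "positive_mat n X \<longleftrightarrow> X \<in> carrier_mat n n \<and> (\<forall>v\<in>carrier_vec n. 0 \<le> (X *\<^sub>v v) \<bullet>c v)"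

text \<open>By the dimension count, an orthonormal family of \<open>n\<close> vectors in \<open>\<complex>\<^sup>n\<close> is a basis.\<close>

definition orthonormal_basis :: "nat \<Rightarrow> (nat \<Rightarrow> complex vec) \<Rightarrow> bool" where
  "orthonormal_basis n b \<longleftrightarrow> (\<forall>i<n. b i \<in> carrier_vec n) \<and>
     (\<forall>i<n. \<forall>j<n. b i \<bullet>c b j = (if i = j then 1 else 0))"

text \<open>Trace over the middle factor of \<open>\<complex>\<^sup>l \<otimes> \<complex>\<^sup>m \<otimes> \<complex>\<^sup>n\<close>.\<close>

definition ptrace :: "nat \<Rightarrow> nat \<Rightarrow> nat \<Rightarrow> complex mat \<Rightarrow> complex mat" where
  "ptrace l m n X = mat (l * n) (l * n) (\<lambda>(s, t). \<Sum>b<m.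
     X $$ ((s div n * m + b) * n + s mod n, (t div n * m + b) * n + t mod n))"

text \<open>The flip \<open>|i\<rangle> \<otimes> |j\<rangle> \<mapsto> |j\<rangle> \<otimes> |i\<rangle>\<close> on \<open>\<complex>\<^sup>2 \<otimes> \<complex>\<^sup>2\<close>.\<close>

definition swap_mat :: "complex mat" where
  "swap_mat = mat 4 4 (\<lambda>(s, t). if s div 2 = t mod 2 \<and> s mod 2 = t div 2 then 1 else 0)"

section \<open>Channels\<close>

text \<open>\<open>ampl d e k \<Phi>\<close> is \<open>\<Phi> \<otimes> id\<close> on \<open>B(\<complex>\<^sup>d \<otimes> \<complex>\<^sup>k)\<close>, with values in \<open>B(\<complex>\<^sup>e \<otimes> \<complex>\<^sup>k)\<close>: \<open>\<Phi>\<close> is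
  applied to each of the \<open>k\<^sup>2\<close> blocks obtained by fixing the two indices of the ancilla.\<close>

definition ampl :: "nat \<Rightarrow> nat \<Rightarrow> nat \<Rightarrow> (complex mat \<Rightarrow> complex mat) \<Rightarrow> complex mat \<Rightarrow> complex mat" where
  "ampl d e k \<Phi> X = mat (e * k) (e * k) (\<lambda>(s, t).
     \<Phi> (mat d d (\<lambda>(a, b). X $$ (a * k + s mod k, b * k + t mod k))) $$ (s div k, t div k))"

definition linear_superop :: "nat \<Rightarrow> nat \<Rightarrow> (complex mat \<Rightarrow> complex mat) \<Rightarrow> bool" where
  "linear_superop d e \<Phi> \<longleftrightarrow>
     (\<forall>X\<in>carrier_mat d d. \<Phi> X \<in> carrier_mat e e) \<and>
     (\<forall>X\<in>carrier_mat d d. \<forall>Y\<in>carrier_mat d d. \<Phi> (X + Y) = \<Phi> X + \<Phi> Y) \<and>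
     (\<forall>c. \<forall>X\<in>carrier_mat d d. \<Phi> (c \<cdot>\<^sub>m X) = c \<cdot>\<^sub>m \<Phi> X)"

definition completely_positive :: "nat \<Rightarrow> nat \<Rightarrow> (complex mat \<Rightarrow> complex mat) \<Rightarrow> bool" where
  "completely_positive d e \<Phi> \<longleftrightarrow>
     (\<forall>k X. positive_mat (d * k) X \<longrightarrow> positive_mat (e * k) (ampl d e k \<Phi> X))"

definition trace_preserving :: "nat \<Rightarrow> (complex mat \<Rightarrow> complex mat) \<Rightarrow> bool" where
  "trace_preserving d \<Phi> \<longleftrightarrow> (\<forall>X\<in>carrier_mat d d. mtrace (\<Phi> X) = mtrace X)"

definition channel :: "nat \<Rightarrow> nat \<Rightarrow> (complex mat \<Rightarrow> complex mat) \<Rightarrow> bool" where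
  "channel d e \<Phi> \<longleftrightarrow> linear_superop d e \<Phi> \<and> completely_positive d e \<Phi> \<and> trace_preserving d \<Phi>"

definition bits2 :: "(nat \<times> nat) set" where
  "bits2 = {0, 1} \<times> {0, 1}"

definition ket2 :: "nat \<times> nat \<Rightarrow> complex vec" where
  "ket2 \<alpha> = kron_vec (unit_vec 2 (fst \<alpha>)) (unit_vec 2 (snd \<alpha>))"

text \<open>The factors of the Choi matrix are, in this order,
  Alice's output, Bob's output, Alice's input, Bob's input.\<close>

definition choi :: "(complex mat \<Rightarrow> complex mat) \<Rightarrow> complex mat" where
  "choi \<Phi> = msum 16 16
     (\<lambda>(\<alpha>, \<beta>). kron (\<Phi> (outer (ket2 \<alpha>) (ket2 \<beta>))) (outer (ket2 \<alpha>) (ket2 \<beta>))) (bits2 \<times> bits2)"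

text \<open>\<open>C\<^sub>B\<close> acts on Bob's output and input, \<open>C\<^sub>A\<close> on Alice's. The product \<open>1 \<otimes> C\<^sub>B\<close> comes with the
  factors Alice's input, Bob's output, Bob's input, whereas tracing out Alice's output leaves
  Bob's output, Alice's input, Bob's input; conjugation by \<^const>\<open>swap_mat\<close> on the first two
  factors reconciles them. In the second equation \<open>C\<^sub>A \<otimes> 1\<close> already has the right order.\<close>

definition non_signaling :: "(complex mat \<Rightarrow> complex mat) \<Rightarrow> bool" where
  "non_signaling \<Phi> \<longleftrightarrow>
     (\<exists>C\<^sub>B. positive_mat 4 C\<^sub>B \<and>
        ptrace 1 2 8 (choi \<Phi>) = kron swap_mat (1\<^sub>m 2) * kron (1\<^sub>m 2) C\<^sub>B * kron swap_mat (1\<^sub>m 2)) \<and>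
     (\<exists>C\<^sub>A. positive_mat 4 C\<^sub>A \<and> ptrace 2 2 4 (choi \<Phi>) = kron C\<^sub>A (1\<^sub>m 2))"

section \<open>Measurements and PR-channels\<close>

text \<open>\<open>Unprimed\<close> stands for \<open>A\<close> and \<open>B\<close>, \<open>Primed\<close> for \<open>A'\<close> and \<open>B'\<close>.\<close>

datatype setting = Unprimed | Primed

text \<open>A measurement on qubit channels is given by an input vector and an output basis.\<close>

type_synonym channel_measurement = "complex vec \<times> (nat \<Rightarrow> complex vec)"

fun max_incompatible :: "(nat \<Rightarrow> complex vec) \<Rightarrow> setting \<Rightarrow> channel_measurement" where
  "max_incompatible \<eta> Unprimed = (unit_vec 2 0, unit_vec 2)"
| "max_incompatible \<eta> Primed = (unit_vec 2 1, \<eta>)"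

definition outcome_index :: "int \<Rightarrow> nat" where
  "outcome_index \<epsilon> = (if \<epsilon> = 1 then 0 else 1)"

text \<open>The Born rule. For a channel and orthonormal bases the value is real.\<close>

definition joint_prob ::
  "(complex mat \<Rightarrow> complex mat) \<Rightarrow> int \<Rightarrow> int \<Rightarrow> channel_measurement \<Rightarrow> channel_measurement \<Rightarrow> complex" where
  "joint_prob \<Phi> \<epsilon> \<delta> M N =
     (let inp = kron_vec (fst M) (fst N);
          out = kron_vec (snd M (outcome_index \<epsilon>)) (snd N (outcome_index \<delta>))
      in mtrace (outer out out * \<Phi> (outer inp inp)))"

definition PR_channel ::
  "(nat \<Rightarrow> complex vec) \<Rightarrow> (nat \<Rightarrow> complex vec) \<Rightarrow> (complex mat \<Rightarrow> complex mat) \<Rightarrow> bool" where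
  "PR_channel \<eta>\<^sub>A \<eta>\<^sub>B \<Phi> \<longleftrightarrow> channel 4 4 \<Phi> \<and> non_signaling \<Phi> \<and>
     (\<forall>c d. \<forall>\<epsilon>\<in>{1, -1}. \<forall>\<delta>\<in>{1, -1}.
        joint_prob \<Phi> \<epsilon> \<delta> (max_incompatible \<eta>\<^sub>A c) (max_incompatible \<eta>\<^sub>B d) =
          (if ((c, d) \<noteq> (Primed, Primed) \<and> \<epsilon> * \<delta> = 1) \<or> ((c, d) = (Primed, Primed) \<and> \<epsilon> * \<delta> = -1)
           then 1 / 2 else 0))"

section \<open>Block matrices\<close>

definition B_diag :: "complex \<Rightarrow> complex mat" where
  "B_diag z = mat_of_rows_list 2 [[1, z], [cnj z, 1]]"

definition B_off :: "complex \<Rightarrow> complex \<Rightarrow> complex mat" where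
  "B_off x y = mat_of_rows_list 2 [[0, x], [y, 0]]"

text \<open>The basis of \<open>\<complex>\<^sup>r\<close> is indexed by \<open>p < r\<close>, starting at \<open>0\<close>.\<close>

definition B_block ::
  "nat \<Rightarrow> (nat \<Rightarrow> complex) \<Rightarrow> (nat \<Rightarrow> nat \<Rightarrow> complex) \<Rightarrow> (nat \<Rightarrow> nat \<Rightarrow> complex) \<Rightarrow> complex mat" where
  "B_block r z x y = (1 / 2) \<cdot>\<^sub>m
     (msum (2 * r) (2 * r) (\<lambda>p. kron (B_diag (z p)) (outer (unit_vec r p) (unit_vec r p))) {..<r} +
      msum (2 * r) (2 * r) (\<lambda>(p, q). kron (B_off (x p q) (y p q)) (outer (unit_vec r p) (unit_vec r q)))
        {(p, q). p < r \<and> q < r \<and> p \<noteq> q})"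

end

(* Complete positivity gives a Cauchy-Schwarz inequality between the blocks Phi(|alpha><beta|) of the
   Choi matrix, so the zero probabilities of the PR-box force each block to be a 2x2 matrix between the
   two product vectors allowed for alpha and the two allowed for beta. If such a matrix element is nonzero
   for alpha <> beta, the non-signaling conditions make the two product vectors orthogonal in both tensor
   factors. In dimension two, the remaining basis vectors are then parallel, so alpha and beta have the
   same supporting vectors up to order and phases, and the block is off-diagonal in them. Finally, only one
   class of inputs can be related in this way; it is Delta_1. *)
theory Submission
  imports Defs
begin

section \<open>Sums over pairs and sesquilinear forms\<close>

text \<open>Non-signaling becomes orthogonality through a trace over Alice written in two bases at
  once: the rows of a block use the bases attached to one input and the columns those attached to
  the other, so each matrix element is weighted by an overlap of Alice's vectors. If Alice's inputs
  differ, this trace is zero, and since Bob's outcome determines Alice's, only one weighted element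
  is left in it. If her inputs agree, the trace need not vanish, but it does not depend on her
  input; comparing her two inputs brings in all four settings, and the parity contradiction that
  rules out local deterministic PR-boxes excludes equal outcomes. Bob's case is the same with the
  parties exchanged. The relation between inputs obtained in this way is a property of the
  measurement bases alone, not of the channel: it says where coherences are possible. Hence Delta_1
  is read off from the bases, and coefficients inside it may still be zero.\<close>

lemma mult_add_less_mult:
  assumes "i < m" "j < n"
  shows "i * n + j < m * (n :: nat)"
proof -
  have "i * n + j < Suc i * n" using assms(2) by simp
  also have "\<dots> \<le> m * n" using assms(1) by (intro mult_le_mono1) simp
  finally show ?thesis .
qed

lemma sum_lessThan_mult:
  fixes f :: "nat \<Rightarrow> 'a::comm_monoid_add"
  shows "(\<Sum>s<m * n. f s) = (\<Sum>i<m. \<Sum>j<n. f (i * n + j))"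
proof -
  have "sum f {i * n..<i * n + n} = (\<Sum>j<n. f (i * n + j))" for i
    using sum.shift_bounds_nat_ivl[of f 0 "i * n" n]
    by (simp add: add.commute atLeast0LessThan)
  then show ?thesis
    by (simp add: sum.nat_group[symmetric])
qed

text \<open>This is a 2x2 form tested on the vectors (1, c). The values c = 1, -1 and \<i> force it
  to be Hermitian; a discriminant argument then gives the determinant inequality.\<close>

lemma quadratic_form_nonneg:
  fixes p q g h :: complex
  assumes nonneg: "\<And>c. 0 \<le> p + c * h + cnj c * g + c * cnj c * q"
  shows "g = cnj h" and "(cmod h)\<^sup>2 \<le> Re p * Re q"
proof -
  have p: "0 \<le> Re p" "Im p = 0"
    using nonneg[of 0] by (simp_all add: less_eq_complex_def)
  have c1: "0 \<le> p + h + g + q" and c2: "0 \<le> p - h - g + q"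
    using nonneg[of 1] nonneg[of "-1"] by simp_all
  have ci: "0 \<le> p + \<i> * h - \<i> * g + q"
    using nonneg[of \<i>] by simp
  have q: "Im q = 0" and "Im g = - Im h" "Re g = Re h"
    using p c1 c2 ci by (auto simp: less_eq_complex_def)
  then show g: "g = cnj h"
    by (simp add: complex_eq_iff)
  define n where "n = (cmod h)\<^sup>2"
  have hh: "h * cnj h = complex_of_real n"
    unfolding n_def using complex_norm_square by metis
  \<comment> \<open>With c = -t * cnj h both cross terms equal -t * n, which leaves a real quadratic
    polynomial in t.\<close>
  have ineq: "0 \<le> Re p - 2 * t * n + t\<^sup>2 * n * Re q" for t
  proof -
    have "p + (- of_real t * cnj h) * h + cnj (- of_real t * cnj h) * g
        + (- of_real t * cnj h) * cnj (- of_real t * cnj h) * q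
        = p - 2 * of_real t * (h * cnj h) + (of_real t)\<^sup>2 * (h * cnj h) * q"
      by (simp add: g algebra_simps power2_eq_square)
    also have "\<dots> = p - complex_of_real (2 * t * n) + complex_of_real (t\<^sup>2 * n) * q"
      by (simp add: hh)
    finally have "0 \<le> p - complex_of_real (2 * t * n) + complex_of_real (t\<^sup>2 * n) * q"
      using nonneg[of "- of_real t * cnj h"] by metis
    then show ?thesis
      by (simp add: less_eq_complex_def)
  qed
  have n0: "0 \<le> n" by (simp add: n_def)
  have "n \<le> Re p * Re q"
  proof (cases "n = 0")
    case True
    \<comment> \<open>With h = g = 0, a negative \<open>Re q\<close> would give the form the value
      -1 at the square root chosen below.\<close>
    have "0 \<le> Re q"
    proof (rule ccontr)
      assume "\<not> 0 \<le> Re q"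
      have "h = 0" using True n_def by simp
      have "0 \<le> Re p + t\<^sup>2 * Re q" for t
        using nonneg[of "of_real t"] g \<open>h = 0\<close>
        by (simp add: less_eq_complex_def power2_eq_square)
      from this[of "sqrt ((Re p + 1) / (- Re q))"] show False
        using \<open>\<not> 0 \<le> Re q\<close> p by (simp add: field_simps)
    qed
    then show ?thesis using True p by simp
  next
    case False
    with n0 have n: "0 < n" by simp
    show ?thesis
    proof (cases "Re q \<le> 0")
      case True
      \<comment> \<open>The linear term then exceeds \<open>Re p\<close> by 1 while the quadratic
        term is at most 0, which contradicts \<open>ineq\<close>.\<close>
      define t where "t = (Re p + 1) / (2 * n)"
      have "2 * t * n = Re p + 1" using n by (simp add: t_def field_simps)
      moreover have "t\<^sup>2 * n * Re q \<le> 0"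
        using True n by (simp add: mult_nonneg_nonpos)
      ultimately show ?thesis using ineq[of t] by simp
    next
      case False
      then have "0 < Re q" by simp
      \<comment> \<open>The quadratic polynomial attains its minimum at 1 /
        \<open>Re q\<close>.\<close>
      then show ?thesis
        using ineq[of "1 / Re q"] by (simp add: field_simps power2_eq_square)
    qed
  qed
  then show "(cmod h)\<^sup>2 \<le> Re p * Re q" by (simp add: n_def)
qed

section \<open>Matrix elements of operators, and their Cauchy-Schwarz inequality from complete
  positivity\<close>

definition sesq :: "complex mat \<Rightarrow> complex vec \<Rightarrow> complex vec \<Rightarrow> complex" where
  "sesq X v w = (\<Sum>s<dim_vec v. \<Sum>t<dim_vec w. cnj (v $ s) * X $$ (s, t) * w $ t)"

lemma sesq_smult: "sesq X (c \<cdot>\<^sub>v v) (d \<cdot>\<^sub>v w) = cnj c * d * sesq X v w"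
  by (simp add: sesq_def sum_distrib_left mult_ac)

lemma sesq_conv_scalar_prod:
  assumes "X \<in> carrier_mat m n" "v \<in> carrier_vec m" "w \<in> carrier_vec n"
  shows "(X *\<^sub>v w) \<bullet>c v = sesq X v w"
  using assms
  by (auto simp: sesq_def scalar_prod_def atLeast0LessThan sum_distrib_left sum_distrib_right
      mult_ac intro!: sum.cong)

text \<open>A resolution of the identity is inserted on each side of \<open>X\<close>. The two
  families may differ, and the index sets are arbitrary so that pairs can index a product
  basis.\<close>

lemma complete_sesq:
  assumes w: "\<And>s s'. s < m \<Longrightarrow> s' < m \<Longrightarrow> (\<Sum>i\<in>I. w i $ s * cnj (w i $ s')) = (if s = s' then 1 else 0)"
    and w': "\<And>t t'. t < n \<Longrightarrow> t' < n \<Longrightarrow> (\<Sum>j\<in>J. w' j $ t * cnj (w' j $ t')) = (if t = t' then 1 else 0)"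
    and dim: "\<And>i. i \<in> I \<Longrightarrow> dim_vec (w i) = m" "\<And>j. j \<in> J \<Longrightarrow> dim_vec (w' j) = n"
    and st: "s < m" "t < n"
  shows "(\<Sum>i\<in>I. \<Sum>j\<in>J. w i $ s * sesq X (w i) (w' j) * cnj (w' j $ t)) = X $$ (s, t)"
proof -
  have "(\<Sum>i\<in>I. \<Sum>j\<in>J. w i $ s * sesq X (w i) (w' j) * cnj (w' j $ t))
      = (\<Sum>i\<in>I. \<Sum>j\<in>J. \<Sum>s'<m. \<Sum>t'<n.
          (w i $ s * cnj (w i $ s')) * X $$ (s', t') * (w' j $ t' * cnj (w' j $ t)))"
    by (intro sum.cong refl) (simp add: sesq_def dim sum_distrib_left sum_distrib_right mult_ac)
  also have "\<dots> = (\<Sum>i\<in>I. \<Sum>s'<m. \<Sum>t'<n. \<Sum>j\<in>J.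
          (w i $ s * cnj (w i $ s')) * X $$ (s', t') * (w' j $ t' * cnj (w' j $ t)))"
    by (intro sum.cong refl, subst sum.swap, rule sum.cong[OF refl], rule sum.swap)
  also have "\<dots> = (\<Sum>s'<m. \<Sum>t'<n. \<Sum>i\<in>I. \<Sum>j\<in>J.
          (w i $ s * cnj (w i $ s')) * X $$ (s', t') * (w' j $ t' * cnj (w' j $ t)))"
    by (subst sum.swap, rule sum.cong[OF refl], rule sum.swap)
  also have "\<dots> = (\<Sum>s'<m. \<Sum>t'<n. (\<Sum>i\<in>I. w i $ s * cnj (w i $ s')) * X $$ (s', t')
          * (\<Sum>j\<in>J. w' j $ t' * cnj (w' j $ t)))"
    by (intro sum.cong refl) (simp add: sum_distrib_right mult.assoc, simp add: sum_distrib_left)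
  also have "\<dots> = (\<Sum>s'<m. \<Sum>t'<n. (if s = s' then 1 else 0) * X $$ (s', t') * (if t' = t then 1 else 0))"
    by (intro sum.cong refl) (simp add: w w' st)
  also have "\<dots> = X $$ (s, t)"
    using st by (simp add: if_distrib[of "\<lambda>x. _ * x"] if_distrib[of "\<lambda>x. x * _"] cong: if_cong)
  finally show ?thesis .
qed

lemma positive_mat_outer:
  assumes "x \<in> carrier_vec n"
  shows "positive_mat n (outer x x)"
proof -
  have "0 \<le> (outer x x *\<^sub>v v) \<bullet>c v" if "v \<in> carrier_vec n" for v
  proof -
    have "(outer x x *\<^sub>v v) \<bullet>c v = (\<Sum>s<n. \<Sum>t<n. cnj (v $ s) * (x $ s * cnj (x $ t)) * v $ t)"
      using assms that by (subst sesq_conv_scalar_prod) (auto simp: sesq_def outer_def)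
    also have "\<dots> = (\<Sum>s<n. cnj (v $ s) * x $ s) * cnj (\<Sum>t<n. cnj (v $ t) * x $ t)"
      by (simp add: sum_product) (simp add: mult_ac)
    also have "0 \<le> z * cnj z" for z
      by (simp add: less_eq_complex_def)
    finally show ?thesis .
  qed
  then show ?thesis
    using assms by (simp add: positive_mat_def outer_def)
qed

text \<open>A qubit ancilla collects the four operators in one positive matrix: the amplified map is
  applied to the projector of x (x) |0> + y (x) |1>, and the result is tested on v (x) |0> + c w (x)
  |1>. The ancilla index is the last binary digit.\<close>

lemma completely_positive_sesq_nonneg:
  assumes cp: "completely_positive d e \<Phi>"
    and x: "x \<in> carrier_vec d" and y: "y \<in> carrier_vec d"
    and v: "v \<in> carrier_vec e" and w: "w \<in> carrier_vec e"
  shows "0 \<le> sesq (\<Phi> (outer x x)) v v + c * sesq (\<Phi> (outer x y)) v w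
    + cnj c * sesq (\<Phi> (outer y x)) w v + c * cnj c * sesq (\<Phi> (outer y y)) w w"
proof -
  define g where "g s = (if s = 0 then x else y)" for s :: nat
  define h where "h s = (if s = 0 then v else c \<cdot>\<^sub>v w)" for s :: nat
  define \<omega> where "\<omega> = vec (d * 2) (\<lambda>s. g (s mod 2) $ (s div 2))"
  define u where "u = vec (e * 2) (\<lambda>s. h (s mod 2) $ (s div 2))"
  define X where "X = ampl d e 2 \<Phi> (outer \<omega> \<omega>)"
  have dg: "dim_vec (g s) = d" and dh: "dim_vec (h s) = e" for s
    using x y v w by (auto simp: g_def h_def)
  have block: "mat d d (\<lambda>(a, b). outer \<omega> \<omega> $$ (a * 2 + s mod 2, b * 2 + t mod 2))
      = outer (g (s mod 2)) (g (t mod 2))" for s t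
  proof -
    show ?thesis
      by (intro eq_matI) (auto simp: outer_def \<omega>_def dg mult_add_less_mult)
  qed
  have X: "X $$ (s, t) = \<Phi> (outer (g (s mod 2)) (g (t mod 2))) $$ (s div 2, t div 2)"
    if "s < e * 2" "t < e * 2" for s t
    using that by (simp add: X_def ampl_def block)
  have pos: "positive_mat (e * 2) X"
    unfolding X_def using cp positive_mat_outer[of \<omega> "d * 2"]
    by (auto simp: completely_positive_def \<omega>_def)
  have u: "u \<in> carrier_vec (e * 2)" by (simp add: u_def)
  have "0 \<le> (X *\<^sub>v u) \<bullet>c u"
    using pos u by (simp add: positive_mat_def)
  also have "(X *\<^sub>v u) \<bullet>c u = sesq X u u"
    using pos u by (auto simp: positive_mat_def intro: sesq_conv_scalar_prod)
  also have "\<dots> = (\<Sum>i<e. \<Sum>j<2. \<Sum>i'<e. \<Sum>j'<2.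
      cnj (h j $ i) * \<Phi> (outer (g j) (g j')) $$ (i, i') * h j' $ i')"
    unfolding sesq_def using u
    by (simp add: sum_lessThan_mult, intro sum.cong refl)
       (simp add: X mult_add_less_mult u_def div_add1_eq)
  also have "\<dots> = (\<Sum>j<2. \<Sum>j'<2. sesq (\<Phi> (outer (g j) (g j'))) (h j) (h j'))"
    unfolding sesq_def dh
    by (subst sum.swap, rule sum.cong[OF refl])
       (simp only: sum.swap[of _ "{..<2}" "{..<e}"])
  also have "\<dots> = sesq (\<Phi> (outer x x)) v v + c * sesq (\<Phi> (outer x y)) v w
    + cnj c * sesq (\<Phi> (outer y x)) w v + c * cnj c * sesq (\<Phi> (outer y y)) w w"
    using sesq_smult[of _ 1 v c w] sesq_smult[of _ c w 1 v] sesq_smult[of _ c w c w]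
    by (simp add: numeral_2_eq_2 g_def h_def)
  finally show ?thesis .
qed

lemma completely_positive_sesq_cauchy_schwarz:
  assumes "completely_positive d e \<Phi>"
    and "x \<in> carrier_vec d" "y \<in> carrier_vec d" "v \<in> carrier_vec e" "w \<in> carrier_vec e"
  shows "sesq (\<Phi> (outer y x)) w v = cnj (sesq (\<Phi> (outer x y)) v w)"
    and "(cmod (sesq (\<Phi> (outer x y)) v w))\<^sup>2
      \<le> Re (sesq (\<Phi> (outer x x)) v v) * Re (sesq (\<Phi> (outer y y)) w w)"
  using quadratic_form_nonneg[OF completely_positive_sesq_nonneg[OF assms]] by auto

section \<open>Combinatorics of the PR-box\<close>

text \<open>For the settings \<open>k\<close> and \<open>m\<close> (\<open>0\<close> unprimed, \<open>1\<close> primed), the PR-box allows Bob's outcome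
  index \<open>j\<close> together with Alice's \<open>i\<close> iff \<open>j = partner k m i\<close>.\<close>

definition partner :: "nat \<Rightarrow> nat \<Rightarrow> nat \<Rightarrow> nat" where
  "partner k m i = (if k = 1 \<and> m = 1 then 1 - i else i)"

lemma partner_less [simp]: "i < 2 \<Longrightarrow> partner k m i < 2"
  by (auto simp: partner_def)

lemma partner_flip: "i < 2 \<Longrightarrow> partner k m (1 - i) = 1 - partner k m i"
  by (auto simp: partner_def)

text \<open>The PR-box rule is i + j = km modulo 2, which is symmetric in the two parties; this lets
  Bob's case reuse Alice's.\<close>

lemma partner_commute: "i < 2 \<Longrightarrow> j < 2 \<Longrightarrow> j = partner k m i \<longleftrightarrow> i = partner m k j"
  by (auto simp: partner_def)

lemma partner_inject: "i < 2 \<Longrightarrow> i' < 2 \<Longrightarrow> partner k m i = partner k m i' \<longleftrightarrow> i = i'"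
  by (auto simp: partner_def)

text \<open>Modulo 2, adding the two equations gives (k + k')(m + m') = 0, whereas both factors are
  1. In other words, no assignment of outcomes to all four measurements is compatible with the
  PR-box.\<close>

lemma partner_parity:
  assumes "k < 2" "k' < 2" "m < 2" "m' < 2" "i < 2" "i' < 2" "k \<noteq> k'" "m \<noteq> m'"
  shows "\<not> (partner k m i = partner k' m i' \<and> partner k m' i = partner k' m' i')"
  using assms by (auto simp: partner_def; presburger)

lemma sum_lessThan_2: "(\<Sum>i<2. f i) = f 0 + f (1::nat)"
  by (simp add: numeral_2_eq_2)

lemma less_2_iff: "(i::nat) < 2 \<longleftrightarrow> i = 0 \<or> i = 1"
  by auto

lemma ex_less_2: "(\<exists>i<2. P i) \<longleftrightarrow> P 0 \<or> P (1::nat)"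
  by (auto simp: less_2_iff)

text \<open>\<open>F k m k' m' i j i' j'\<close> stands for the matrix elements of \<open>\<Phi>(|km\<rangle>\<langle>k'm'|)\<close> and \<open>ov\<close> for the overlaps
  of Alice's bases, so that the sum is a matrix element of a partial trace. If \<open>k \<noteq> k'\<close>, it vanishes and
  has only one possibly nonzero term. If \<open>k = k'\<close>, then its independence of \<open>k\<close> is used: a contribution
  with \<open>i = i'\<close> for one value of \<open>k\<close> would need an outcome that the PR-box forbids for the other.\<close>

lemma overlap_zero_left:
  fixes F :: "nat \<Rightarrow> nat \<Rightarrow> nat \<Rightarrow> nat \<Rightarrow> nat \<Rightarrow> nat \<Rightarrow> nat \<Rightarrow> nat \<Rightarrow> complex"
    and ov :: "nat \<Rightarrow> nat \<Rightarrow> nat \<Rightarrow> nat \<Rightarrow> complex"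
  assumes supp: "\<And>k m k' m' i j i' j'. \<lbrakk>k < 2; m < 2; k' < 2; m' < 2; i < 2; j < 2; i' < 2; j' < 2;
      F k m k' m' i j i' j' \<noteq> 0\<rbrakk> \<Longrightarrow> j = partner k m i \<and> j' = partner k' m' i'"
    and ov: "\<And>k i i'. \<lbrakk>k < 2; i < 2; i' < 2\<rbrakk> \<Longrightarrow> ov k i k i' = (if i = i' then 1 else 0)"
    and ns: "\<And>k m k' m' j j'. \<lbrakk>k < 2; m < 2; k' < 2; m' < 2; j < 2; j' < 2\<rbrakk> \<Longrightarrow>
      (\<Sum>i<2. \<Sum>i'<2. ov k i k' i' * F k m k' m' i j i' j') = (if k = k' then h m j m' j' else 0)"
    and less: "k < 2" "m < 2" "k' < 2" "m' < 2" "i < 2" "j < 2" "i' < 2" "j' < 2"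
    and neq: "(k, m) \<noteq> (k', m')" and nz: "F k m k' m' i j i' j' \<noteq> 0"
  shows "ov k i k' i' = 0"
proof -
  have single: "(\<Sum>l<2. \<Sum>l'<2. ov \<kappa> l \<kappa>' l' * F \<kappa> \<mu> \<kappa>' \<mu>' l (partner \<kappa> \<mu> p) l' (partner \<kappa>' \<mu>' p'))
      = ov \<kappa> p \<kappa>' p' * F \<kappa> \<mu> \<kappa>' \<mu>' p (partner \<kappa> \<mu> p) p' (partner \<kappa>' \<mu>' p')"
    if "\<kappa> < 2" "\<mu> < 2" "\<kappa>' < 2" "\<mu>' < 2" "p < 2" "p' < 2" for \<kappa> \<mu> \<kappa>' \<mu>' p p'
  proof -
    have z: "F \<kappa> \<mu> \<kappa>' \<mu>' l (partner \<kappa> \<mu> p) l' (partner \<kappa>' \<mu>' p') = 0"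
      if "l < 2" "l' < 2" "l \<noteq> p \<or> l' \<noteq> p'" for l l'
      using supp[of \<kappa> \<mu> \<kappa>' \<mu>' l "partner \<kappa> \<mu> p" l' "partner \<kappa>' \<mu>' p'"] that
        \<open>\<kappa> < 2\<close> \<open>\<mu> < 2\<close> \<open>\<kappa>' < 2\<close> \<open>\<mu>' < 2\<close> \<open>p < 2\<close> \<open>p' < 2\<close>
      by (metis partner_inject partner_less)
    show ?thesis
      using \<open>p < 2\<close> \<open>p' < 2\<close> z[of 0 0] z[of 0 1] z[of 1 0] z[of 1 1]
      by (auto simp: sum_lessThan_2 less_2_iff)
  qed
  have j: "j = partner k m i" "j' = partner k' m' i'"
    using supp[of k m k' m' i j i' j'] less nz by simp_all
  note s = single[OF less(1-5,7), folded j]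
  show ?thesis
  proof (cases "k = k'")
    case False
    then show ?thesis using ns[of k m k' m' j j'] less s nz by simp
  next
    case True
    have "i \<noteq> i'"
    proof
      assume "i = i'"
      with True s ns[of k m k' m' j j'] less have h: "h m j m' j' = F k m k m' i j i j'"
        by (simp add: ov)
      define k2 where "k2 = 1 - k"
      have k2: "k2 < 2" "k2 \<noteq> k" using less(1) unfolding k2_def by presburger+
      \<comment> \<open>As \<open>k = k'\<close>, the inputs differ in \<open>m\<close>. A nonzero
        element would make \<open>j\<close> and \<open>j'\<close> compatible both with
        \<open>i\<close> at \<open>k\<close> and with \<open>l\<close> at \<open>k2\<close>, against
        \<open>partner_parity\<close>.\<close>
      have z: "F k2 m k2 m' l j l j' = 0" if "l < 2" for l
        using supp[of k2 m k2 m' l j l j'] that less k2 j True neq \<open>i = i'\<close>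
          partner_parity[of k k2 m m' i l] by auto
      have "h m j m' j' = 0"
        using ns[of k2 m k2 m' j j'] less k2 z[of 0] z[of 1] by (simp add: sum_lessThan_2 ov)
      with h nz True \<open>i = i'\<close> show False by simp
    qed
    with True show ?thesis using ov less by simp
  qed
qed

text \<open>Bob's half is Alice's with the arguments of \<open>F\<close> transposed;
  \<open>partner_commute\<close> transfers the support condition.\<close>

lemma overlap_zero:
  fixes F :: "nat \<Rightarrow> nat \<Rightarrow> nat \<Rightarrow> nat \<Rightarrow> nat \<Rightarrow> nat \<Rightarrow> nat \<Rightarrow> nat \<Rightarrow> complex"
    and ovA ovB :: "nat \<Rightarrow> nat \<Rightarrow> nat \<Rightarrow> nat \<Rightarrow> complex"
  assumes supp: "\<And>k m k' m' i j i' j'. \<lbrakk>k < 2; m < 2; k' < 2; m' < 2; i < 2; j < 2; i' < 2; j' < 2;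
      F k m k' m' i j i' j' \<noteq> 0\<rbrakk> \<Longrightarrow> j = partner k m i \<and> j' = partner k' m' i'"
    and ovA: "\<And>k i i'. \<lbrakk>k < 2; i < 2; i' < 2\<rbrakk> \<Longrightarrow> ovA k i k i' = (if i = i' then 1 else 0)"
    and ovB: "\<And>m j j'. \<lbrakk>m < 2; j < 2; j' < 2\<rbrakk> \<Longrightarrow> ovB m j m j' = (if j = j' then 1 else 0)"
    and nsA: "\<And>k m k' m' j j'. \<lbrakk>k < 2; m < 2; k' < 2; m' < 2; j < 2; j' < 2\<rbrakk> \<Longrightarrow>
      (\<Sum>i<2. \<Sum>i'<2. ovA k i k' i' * F k m k' m' i j i' j') = (if k = k' then hB m j m' j' else 0)"
    and nsB: "\<And>k m k' m' i i'. \<lbrakk>k < 2; m < 2; k' < 2; m' < 2; i < 2; i' < 2\<rbrakk> \<Longrightarrow>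
      (\<Sum>j<2. \<Sum>j'<2. ovB m j m' j' * F k m k' m' i j i' j') = (if m = m' then hA k i k' i' else 0)"
    and less: "k < 2" "m < 2" "k' < 2" "m' < 2" "i < 2" "j < 2" "i' < 2" "j' < 2"
    and neq: "(k, m) \<noteq> (k', m')" and nz: "F k m k' m' i j i' j' \<noteq> 0"
  shows "ovA k i k' i' = 0 \<and> ovB m j m' j' = 0"
proof
  show "ovA k i k' i' = 0"
    by (rule overlap_zero_left[where F = F and h = hB]) (assumption | rule supp ovA nsA less neq nz)+
  show "ovB m j m' j' = 0"
  proof (rule overlap_zero_left[where F = "\<lambda>m k m' k' j i j' i'. F k m k' m' i j i' j'" and h = hA])
    show "i = partner m k j \<and> i' = partner m' k' j'"
      if "m < 2" "k < 2" "m' < 2" "k' < 2" "j < 2" "i < 2" "j' < 2" "i' < 2" "F k m k' m' i j i' j' \<noteq> 0"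
      for m k m' k' j i j' i'
      using supp[of k m k' m' i j i' j'] that partner_commute by metis
    show "(m, k) \<noteq> (m', k')" using neq by auto
  qed (assumption | rule ovB nsB less nz)+
qed

text \<open>\<open>ZA k i k' i'\<close> says that the \<open>i\<close>-th vector of Alice's \<open>k\<close>-th basis is orthogonal to the \<open>i'\<close>-th vector
  of her \<open>k'\<close>-th one. In dimension two this makes the remaining basis vectors parallel, so two linked inputs
  have the same supporting product vectors, up to order and phases.\<close>

definition linked ::
  "(nat \<Rightarrow> nat \<Rightarrow> nat \<Rightarrow> nat \<Rightarrow> bool) \<Rightarrow> (nat \<Rightarrow> nat \<Rightarrow> nat \<Rightarrow> nat \<Rightarrow> bool) \<Rightarrow> nat \<times> nat \<Rightarrow> nat \<times> nat \<Rightarrow> bool"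
  where
  "linked ZA ZB \<alpha> \<beta> \<longleftrightarrow> (\<exists>i<2. \<exists>i'<2. ZA (fst \<alpha>) i (fst \<beta>) i' \<and>
     ZB (snd \<alpha>) (partner (fst \<alpha>) (snd \<alpha>) i) (snd \<beta>) (partner (fst \<beta>) (snd \<beta>) i'))"

text \<open>A propositional abstract of two orthonormal bases of a plane: besides symmetry, it
  records that an orthogonal pair leaves an orthogonal pair of complementary vectors and that no
  vector is orthogonal to a whole basis. The classification of inputs thereby becomes a finite
  Boolean check.\<close>

definition orthogonality :: "(nat \<Rightarrow> nat \<Rightarrow> nat \<Rightarrow> nat \<Rightarrow> bool) \<Rightarrow> bool" where
  "orthogonality Z \<longleftrightarrow> (\<forall>k<2. \<forall>k'<2. \<forall>i<2. \<forall>i'<2.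
     (Z k i k' i' \<longrightarrow> Z k' i' k i \<and> Z k (1 - i) k' (1 - i') \<and> \<not> Z k (1 - i) k' i') \<and>
     (Z k i k i' \<longleftrightarrow> i \<noteq> i'))"

text \<open>Only two Boolean unknowns remain, and they exclude each other: \<open>Z 0 0 1 0\<close>
  means that the two bases agree up to phases in opposite order, \<open>Z 0 0 1 1\<close> that they
  agree in the same order.\<close>

lemma orthogonality_simps:
  assumes "orthogonality Z"
  shows "Z 0 0 0 0 = False" "Z 0 (Suc 0) 0 (Suc 0) = False" "Z 0 0 0 (Suc 0) = True" "Z 0 (Suc 0) 0 0 = True"
    "Z (Suc 0) 0 (Suc 0) 0 = False" "Z (Suc 0) (Suc 0) (Suc 0) (Suc 0) = False" "Z (Suc 0) 0 (Suc 0) (Suc 0) = True"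
    "Z (Suc 0) (Suc 0) (Suc 0) 0 = True"
    "Z 0 (Suc 0) (Suc 0) (Suc 0) = Z 0 0 (Suc 0) 0" "Z (Suc 0) 0 0 0 = Z 0 0 (Suc 0) 0" "Z (Suc 0) (Suc 0) 0 (Suc 0) = Z 0 0 (Suc 0) 0"
    "Z 0 (Suc 0) (Suc 0) 0 = Z 0 0 (Suc 0) (Suc 0)" "Z (Suc 0) (Suc 0) 0 0 = Z 0 0 (Suc 0) (Suc 0)" "Z (Suc 0) 0 0 (Suc 0) = Z 0 0 (Suc 0) (Suc 0)"
    "\<not> (Z 0 0 (Suc 0) 0 \<and> Z 0 0 (Suc 0) (Suc 0))"
proof -
  have sym: "Z k i k' i' \<longleftrightarrow> Z k' i' k i"
    and flip: "Z k i k' i' \<longleftrightarrow> Z k (1 - i) k' (1 - i')"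
    and excl: "Z k i k' i' \<Longrightarrow> \<not> Z k (1 - i) k' i'"
    and diag: "Z k i k i' \<longleftrightarrow> i \<noteq> i'"
    if less: "k < 2" "k' < 2" "i < 2" "i' < 2" for k k' i i'
  proof -
    have inv: "1 - (1 - i) = i" "1 - (1 - i') = i'" "1 - i < 2" "1 - i' < 2"
      using that by auto
    note Z = assms[unfolded orthogonality_def, rule_format]
    show "Z k i k' i' \<longleftrightarrow> Z k' i' k i" 
      using Z[of k k' i i'] Z[of k' k i' i] less by blast
    show "Z k i k' i' \<longleftrightarrow> Z k (1 - i) k' (1 - i')"
      using Z[of k k' i i'] Z[of k k' "1 - i" "1 - i'", unfolded inv(1,2)] less inv(3,4) by blast
    show "Z k i k' i' \<Longrightarrow> \<not> Z k (1 - i) k' i'"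
      using Z[of k k' i i'] less by blast
    show "Z k i k i' \<longleftrightarrow> i \<noteq> i'"
      using Z[of k k i i'] less by blast
  qed
  show "Z 0 0 0 0 = False" "Z 0 (Suc 0) 0 (Suc 0) = False" "Z 0 0 0 (Suc 0) = True" "Z 0 (Suc 0) 0 0 = True"
    "Z (Suc 0) 0 (Suc 0) 0 = False" "Z (Suc 0) (Suc 0) (Suc 0) (Suc 0) = False"
    "Z (Suc 0) 0 (Suc 0) (Suc 0) = True" "Z (Suc 0) (Suc 0) (Suc 0) 0 = True"
    by (simp_all add: diag[where k' = 0])
  show "Z 0 (Suc 0) (Suc 0) (Suc 0) = Z 0 0 (Suc 0) 0" "Z 0 (Suc 0) (Suc 0) 0 = Z 0 0 (Suc 0) (Suc 0)"
    using flip[of 0 1 0 0] flip[of 0 1 0 1] by simp_all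
  then show "Z (Suc 0) 0 0 0 = Z 0 0 (Suc 0) 0" "Z (Suc 0) (Suc 0) 0 (Suc 0) = Z 0 0 (Suc 0) 0"
    "Z (Suc 0) (Suc 0) 0 0 = Z 0 0 (Suc 0) (Suc 0)" "Z (Suc 0) 0 0 (Suc 0) = Z 0 0 (Suc 0) (Suc 0)"
    using sym[of 1 0 0 0] sym[of 1 0 1 1] sym[of 1 0 1 0] sym[of 1 0 0 1] by simp_all
  show "\<not> (Z 0 0 (Suc 0) 0 \<and> Z 0 0 (Suc 0) (Suc 0))"
    using excl[of 0 1 0 0] flip[of 0 1 0 1] by simp
qed

text \<open>The unprimed letters stand for bases agreeing in opposite order, the primed ones for the
  same order. Pairs involving the input 11 have the letters interchanged on one side, since the
  PR-box anticorrelates there.\<close>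

lemma linked_simps:
  assumes "orthogonality ZA" "orthogonality ZB"
  defines "a \<equiv> ZA 0 0 (Suc 0) 0" and "a' \<equiv> ZA 0 0 (Suc 0) (Suc 0)"
    and "b \<equiv> ZB 0 0 (Suc 0) 0" and "b' \<equiv> ZB 0 0 (Suc 0) (Suc 0)"
  shows "linked ZA ZB (0, 0) (0, Suc 0) = b'" "linked ZA ZB (0, Suc 0) (0, 0) = b'"
    "linked ZA ZB (0, 0) (Suc 0, 0) = a'" "linked ZA ZB (Suc 0, 0) (0, 0) = a'"
    "linked ZA ZB (0, Suc 0) (Suc 0, Suc 0) = a" "linked ZA ZB (Suc 0, Suc 0) (0, Suc 0) = a"
    "linked ZA ZB (Suc 0, 0) (Suc 0, Suc 0) = b" "linked ZA ZB (Suc 0, Suc 0) (Suc 0, 0) = b"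
    "linked ZA ZB (0, 0) (Suc 0, Suc 0) = (a \<and> b' \<or> a' \<and> b)" "linked ZA ZB (Suc 0, Suc 0) (0, 0) = (a \<and> b' \<or> a' \<and> b)"
    "linked ZA ZB (0, Suc 0) (Suc 0, 0) = (a \<and> b \<or> a' \<and> b')" "linked ZA ZB (Suc 0, 0) (0, Suc 0) = (a \<and> b \<or> a' \<and> b')"
    "linked ZA ZB (0, 0) (0, 0)" "linked ZA ZB (0, Suc 0) (0, Suc 0)"
    "linked ZA ZB (Suc 0, 0) (Suc 0, 0)" "linked ZA ZB (Suc 0, Suc 0) (Suc 0, Suc 0)"
  by (simp_all add: linked_def ex_less_2 partner_def a_def a'_def b_def b'_def
      orthogonality_simps(1-14)[OF assms(1)] orthogonality_simps(1-14)[OF assms(2)]) blast+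

text \<open>Alice's two bases cannot agree both in the same and in the opposite order, and neither can Bob's;
  this excludes two different nontrivial classes of linked inputs.\<close>

lemma linked_linked:
  assumes "orthogonality ZA" "orthogonality ZB"
    and "\<alpha> \<in> bits2" "\<beta> \<in> bits2" "\<alpha>' \<in> bits2" "\<beta>' \<in> bits2"
    and "\<alpha> \<noteq> \<alpha>'" "linked ZA ZB \<alpha> \<alpha>'" "\<beta> \<noteq> \<beta>'" "linked ZA ZB \<beta> \<beta>'"
  shows "linked ZA ZB \<alpha> \<beta>"
proof -
  note o = orthogonality_simps(15)[OF assms(1)] orthogonality_simps(15)[OF assms(2)]
  have b: "\<gamma> = (0, 0) \<or> \<gamma> = (0, Suc 0) \<or> \<gamma> = (Suc 0, 0) \<or> \<gamma> = (Suc 0, Suc 0)" if "\<gamma> \<in> bits2" for \<gamma>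
    using that by (auto simp: bits2_def)
  note l = linked_simps[OF assms(1,2)]
  show ?thesis
    using b[OF assms(3)] b[OF assms(4)] b[OF assms(5)] b[OF assms(6)] assms(7-10) o
    by (elim disjE; simp add: l; blast)
qed

section \<open>Product bases\<close>

lemma kron_vec_index:
  assumes "dim_vec v = m" "dim_vec w = n" "p < m" "q < n"
  shows "kron_vec v w $ (p * n + q) = v $ p * w $ q"
proof -
  have "p * n + q < m * n"
    using assms(3,4) by (rule mult_add_less_mult)
  then show ?thesis
    using assms by (simp add: kron_vec_def)
qed

lemma dim_kron_vec [simp]: "dim_vec (kron_vec v w) = dim_vec v * dim_vec w"
  by (simp add: kron_vec_def)

text \<open>Fixing the indices of the second factor leaves an operator on the first one, so that the
  factor to be traced out is isolated.\<close>

lemma sesq_kron_vec_left: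
  assumes "dim_vec a = m" "dim_vec a' = m'" "dim_vec b = n" "dim_vec b' = n'"
  shows "sesq X (kron_vec a b) (kron_vec a' b') =
    (\<Sum>q<n. \<Sum>q'<n'. cnj (b $ q) * b' $ q' * sesq (mat m m' (\<lambda>(p, p'). X $$ (p * n + q, p' * n' + q'))) a a')"
proof -
  have "sesq X (kron_vec a b) (kron_vec a' b') = (\<Sum>p<m. \<Sum>q<n. \<Sum>p'<m'. \<Sum>q'<n'.
      cnj (b $ q) * b' $ q' * (cnj (a $ p) * X $$ (p * n + q, p' * n' + q') * a' $ p'))"
    by (simp add: sesq_def assms sum_lessThan_mult kron_vec_index[where m = m and n = n]
        kron_vec_index[where m = m' and n = n'] mult_ac)
  also have "\<dots> = (\<Sum>q<n. \<Sum>p<m. \<Sum>q'<n'. \<Sum>p'<m'.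
      cnj (b $ q) * b' $ q' * (cnj (a $ p) * X $$ (p * n + q, p' * n' + q') * a' $ p'))"
    by (subst sum.swap, rule sum.cong[OF refl], rule sum.cong[OF refl], rule sum.swap)
  also have "\<dots> = (\<Sum>q<n. \<Sum>q'<n'. \<Sum>p<m. \<Sum>p'<m'.
      cnj (b $ q) * b' $ q' * (cnj (a $ p) * X $$ (p * n + q, p' * n' + q') * a' $ p'))"
    by (rule sum.cong[OF refl], rule sum.swap)
  also have "\<dots> = (\<Sum>q<n. \<Sum>q'<n'. cnj (b $ q) * b' $ q' * sesq (mat m m' (\<lambda>(p, p'). X $$ (p * n + q, p' * n' + q'))) a a')"
    by (simp add: sesq_def assms sum_distrib_left)
  finally show ?thesis .
qed

lemma sesq_kron_vec_right:
  assumes "dim_vec a = m" "dim_vec a' = m'" "dim_vec b = n" "dim_vec b' = n'"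
  shows "sesq X (kron_vec a b) (kron_vec a' b') =
    (\<Sum>p<m. \<Sum>p'<m'. cnj (a $ p) * a' $ p' * sesq (mat n n' (\<lambda>(q, q'). X $$ (p * n + q, p' * n' + q'))) b b')"
proof -
  have "sesq X (kron_vec a b) (kron_vec a' b') = (\<Sum>p<m. \<Sum>q<n. \<Sum>p'<m'. \<Sum>q'<n'.
      cnj (a $ p) * a' $ p' * (cnj (b $ q) * X $$ (p * n + q, p' * n' + q') * b' $ q'))"
    by (simp add: sesq_def assms sum_lessThan_mult kron_vec_index[where m = m and n = n]
        kron_vec_index[where m = m' and n = n'] mult_ac)
  also have "\<dots> = (\<Sum>p<m. \<Sum>p'<m'. \<Sum>q<n. \<Sum>q'<n'.
      cnj (a $ p) * a' $ p' * (cnj (b $ q) * X $$ (p * n + q, p' * n' + q') * b' $ q'))"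
    by (rule sum.cong[OF refl], rule sum.swap)
  also have "\<dots> = (\<Sum>p<m. \<Sum>p'<m'. cnj (a $ p) * a' $ p' * sesq (mat n n' (\<lambda>(q, q'). X $$ (p * n + q, p' * n' + q'))) b b')"
    by (simp add: sesq_def assms sum_distrib_left)
  finally show ?thesis .
qed

lemma cscalar_prod_conv_sum:
  assumes "dim_vec w = n"
  shows "v \<bullet>c w = (\<Sum>s<n. v $ s * cnj (w $ s))"
  using assms by (simp add: scalar_prod_def atLeast0LessThan)

text \<open>Orthonormality says \<open>N * M = 1\<close> for the matrix \<open>M\<close> with the
  basis vectors as columns; a one-sided inverse of a square matrix is two-sided, and
  \<open>M * N = 1\<close> is completeness.\<close>

lemma orthonormal_basis_complete:
  assumes b: "orthonormal_basis n b" and "s < n" "s' < n"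
  shows "(\<Sum>i<n. b i $ s * cnj (b i $ s')) = (if s = s' then 1 else 0)"
proof -
  define M where "M = mat n n (\<lambda>(s, i). b i $ s)"
  define N where "N = mat n n (\<lambda>(i, s). cnj (b i $ s))"
  have d: "dim_vec (b i) = n" if "i < n" for i
    using b that by (auto simp: orthonormal_basis_def)
  have "N * M = 1\<^sub>m n"
  proof (rule eq_matI)
    fix i j assume "i < dim_row (1\<^sub>m n)" "j < dim_col (1\<^sub>m n)"
    then have "(N * M) $$ (i, j) = b j \<bullet>c b i"
      by (simp add: M_def N_def scalar_prod_def d mult.commute)
    then show "(N * M) $$ (i, j) = 1\<^sub>m n $$ (i, j)"
      using b \<open>i < _\<close> \<open>j < _\<close> by (auto simp: orthonormal_basis_def)
  qed (simp_all add: M_def N_def)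
  then have "M * N = 1\<^sub>m n"
    using mat_mult_left_right_inverse[of N n M] by (simp add: M_def N_def)
  then have "(M * N) $$ (s, s') = 1\<^sub>m n $$ (s, s')" by simp
  then show ?thesis
    using assms by (simp add: M_def N_def scalar_prod_def atLeast0LessThan)
qed

lemma orthonormal_basis_unit_vec: "orthonormal_basis n (unit_vec n)"
proof -
  have "unit_vec n i \<bullet>c unit_vec n j = (if i = j then 1 else (0 :: complex))" if "i < n" "j < n" for i j
  proof -
    have "unit_vec n i \<bullet>c unit_vec n j = (\<Sum>s<n. unit_vec n i $ s * cnj (unit_vec n j $ s))"
      by (rule cscalar_prod_conv_sum) simp
    also have "\<dots> = (\<Sum>s<n. if s = i then (if i = j then 1 else 0) else 0)"
      using that by (intro sum.cong refl) (auto simp: index_unit_vec)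
    also have "\<dots> = (if i = j then 1 else 0)"
      using that by simp
    finally show ?thesis .
  qed
  then show ?thesis
    by (simp add: orthonormal_basis_def)
qed

lemma less_2_flip: "i < 2 \<Longrightarrow> 1 - (1 - i) = i" "(1::nat) - i < 2" "i < 2 \<Longrightarrow> 1 - i \<noteq> i" for i :: nat
  by presburger+

text \<open>Expanding \<open>b j\<close> in the basis \<open>a\<close>, the coefficient at
  \<open>a i\<close> vanishes and dimension two leaves one other vector; comparing norms makes the
  factor a phase.\<close>

lemma orthogonal_parallel:
  assumes a: "orthonormal_basis 2 a" and b: "orthonormal_basis 2 b"
    and i: "i < 2" and j: "j < 2" and z: "a i \<bullet>c b j = 0"
  obtains c where "c * cnj c = 1" "b j = c \<cdot>\<^sub>v a (1 - i)"
proof -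
  define c where "c = b j \<bullet>c a (1 - i)"
  have d: "dim_vec (a l) = 2" "dim_vec (b l) = 2" if "l < 2" for l
    using a b that by (auto simp: orthonormal_basis_def)
  have z': "b j \<bullet>c a i = 0"
  proof -
    have "b j \<bullet>c a i = cnj (a i \<bullet>c b j)"
      using d i j by (simp add: cscalar_prod_conv_sum[where n = 2] mult.commute)
    then show ?thesis using z by simp
  qed
  have bs: "b j $ s = c * a (1 - i) $ s" if "s < 2" for s
  proof -
    have "b j $ s = (\<Sum>t<2. (\<Sum>l<2. a l $ s * cnj (a l $ t)) * b j $ t)"
      using that by (simp add: orthonormal_basis_complete[OF a] if_distrib[of "\<lambda>x. x * _"] cong: if_cong)
    also have "\<dots> = (\<Sum>l<2. (b j \<bullet>c a l) * a l $ s)"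
      by (simp add: cscalar_prod_conv_sum[where n = 2] d sum_lessThan_2 algebra_simps)
    also have "\<dots> = c * a (1 - i) $ s"
      using i z' by (auto simp: sum_lessThan_2 less_2_iff c_def)
    finally show ?thesis .
  qed
  then have eq: "b j = c \<cdot>\<^sub>v a (1 - i)"
    using d[OF j] d[OF less_2_flip(2)[of i]] by (intro eq_vecI) auto
  have "1 = b j \<bullet>c b j"
    using b j by (simp add: orthonormal_basis_def)
  also have "\<dots> = c * cnj c * (a (1 - i) \<bullet>c a (1 - i))"
    using d less_2_flip(2)[of i] unfolding eq
    by (simp add: cscalar_prod_conv_sum[where n = 2] sum_lessThan_2 algebra_simps)
  also have "a (1 - i) \<bullet>c a (1 - i) = 1"
    using a less_2_flip(2)[of i] by (simp add: orthonormal_basis_def)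
  finally show ?thesis
    using that eq by simp
qed

text \<open>Everything follows from \<open>b k' i'\<close> being a nonzero multiple of
  \<open>b k (1 - i)\<close>: what is orthogonal to the one is orthogonal to the other.\<close>

lemma orthogonality_orthonormal_bases:
  assumes b: "\<And>k. k < 2 \<Longrightarrow> orthonormal_basis 2 (b k)"
  shows "orthogonality (\<lambda>k i k' i'. b k i \<bullet>c b k' i' = 0)"
  unfolding orthogonality_def
proof (intro allI impI conjI)
  fix k k' i i' :: nat
  assume k: "k < 2" "k' < 2" and i: "i < 2" "i' < 2"
  have d: "dim_vec (b k i) = 2" if "k < 2" "i < 2" for k i
    using b that by (auto simp: orthonormal_basis_def)
  have conj: "b k i \<bullet>c b k' i' = cnj (b k' i' \<bullet>c b k i)" if "k < 2" "k' < 2" "i < 2" "i' < 2" for k k' i i'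
    using d that by (simp add: cscalar_prod_conv_sum[where n = 2] mult.commute)
  have o: "b k i \<bullet>c b k i' = (if i = i' then 1 else 0)" if "k < 2" "i < 2" "i' < 2" for k i i'
    using b that by (simp add: orthonormal_basis_def)
  show "b k i \<bullet>c b k i' = 0 \<longleftrightarrow> i \<noteq> i'"
    using o k i by simp
  assume z: "b k i \<bullet>c b k' i' = 0"
  then show "b k' i' \<bullet>c b k i = 0"
    using conj[of k' k i' i] k i by simp
  obtain c where c: "c * cnj c = 1" "b k' i' = c \<cdot>\<^sub>v b k (1 - i)"
    using orthogonal_parallel[OF b b i z] k by blast
  then have c0: "c \<noteq> 0" by auto
  have "b k' (1 - i') \<bullet>c b k' i' = cnj c * (b k' (1 - i') \<bullet>c b k (1 - i))"
    using c(2) d k i less_2_flip(2)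
    by (simp add: cscalar_prod_conv_sum[where n = 2] sum_lessThan_2 algebra_simps)
  then have "b k' (1 - i') \<bullet>c b k (1 - i) = 0"
    using o[of k' "1 - i'" i'] k i less_2_flip[of i'] c0 by simp
  then show "b k (1 - i) \<bullet>c b k' (1 - i') = 0"
    using conj[of k k' "1 - i" "1 - i'"] k i less_2_flip(2) by simp
  have "b k (1 - i) \<bullet>c b k' i' = cnj c * (b k (1 - i) \<bullet>c b k (1 - i))"
    using c(2) d k i less_2_flip(2)
    by (simp add: cscalar_prod_conv_sum[where n = 2] sum_lessThan_2 algebra_simps)
  then show "b k (1 - i) \<bullet>c b k' i' \<noteq> 0"
    using o k i less_2_flip(2) c0 by simp
qed

lemma kron_vec_smult: "kron_vec (c \<cdot>\<^sub>v a) (d \<cdot>\<^sub>v b) = (c * d) \<cdot>\<^sub>v kron_vec a b"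
proof (rule eq_vecI)
  fix s assume "s < dim_vec ((c * d) \<cdot>\<^sub>v kron_vec a b)"
  then have "s < dim_vec a * dim_vec b" by simp
  moreover from this have "s div dim_vec b < dim_vec a"
    by (simp add: less_mult_imp_div_less)
  moreover have "s mod dim_vec b < dim_vec b"
    using \<open>s < dim_vec a * dim_vec b\<close> by (intro mod_less_divisor) (metis mult_0_right not_gr_zero not_less_zero)
  ultimately show "kron_vec (c \<cdot>\<^sub>v a) (d \<cdot>\<^sub>v b) $ s = ((c * d) \<cdot>\<^sub>v kron_vec a b) $ s"
    by (simp add: kron_vec_def)
qed (simp add: kron_vec_def)

lemma kron_vec_complete:
  assumes a: "orthonormal_basis m a" and b: "orthonormal_basis n b" and s: "s < m * n" "s' < m * n"
  shows "(\<Sum>(i, j)\<in>{..<m} \<times> {..<n}. kron_vec (a i) (b j) $ s * cnj (kron_vec (a i) (b j) $ s')) = (if s = s' then 1 else 0)"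
proof -
  have d: "dim_vec (a l) = m" if "l < m" for l
    using a that by (auto simp: orthonormal_basis_def)
  have d': "dim_vec (b l) = n" if "l < n" for l
    using b that by (auto simp: orthonormal_basis_def)
  have n: "0 < n" using s(1) by (cases n) auto
  have "(\<Sum>(i, j)\<in>{..<m} \<times> {..<n}. kron_vec (a i) (b j) $ s * cnj (kron_vec (a i) (b j) $ s'))
      = (\<Sum>i<m. \<Sum>j<n. (a i $ (s div n) * cnj (a i $ (s' div n))) * (b j $ (s mod n) * cnj (b j $ (s' mod n))))"
    unfolding sum.cartesian_product[symmetric] using s
    by (intro sum.cong refl) (simp add: kron_vec_def d d')
  also have "\<dots> = (\<Sum>i<m. a i $ (s div n) * cnj (a i $ (s' div n))) * (\<Sum>j<n. b j $ (s mod n) * cnj (b j $ (s' mod n)))"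
    by (simp add: sum_product)
  also have "\<dots> = (if s div n = s' div n then 1 else 0) * (if s mod n = s' mod n then 1 else 0)"
    using s n by (simp add: orthonormal_basis_complete[OF a] orthonormal_basis_complete[OF b] less_mult_imp_div_less)
  also have "\<dots> = (if s = s' then 1 else 0)"
  proof -
    have "s = s' \<longleftrightarrow> s div n = s' div n \<and> s mod n = s' mod n"
      by (metis div_mult_mod_eq)
    then show ?thesis by simp
  qed
  finally show ?thesis .
qed

lemma cscalar_prod_kron_vec:
  assumes "dim_vec a' = dim_vec a" "dim_vec b' = dim_vec b"
  shows "kron_vec a b \<bullet>c kron_vec a' b' = (a \<bullet>c a') * (b \<bullet>c b')"
proof -
  have "kron_vec a b \<bullet>c kron_vec a' b' = (\<Sum>p<dim_vec a. \<Sum>q<dim_vec b.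
      (a $ p * cnj (a' $ p)) * (b $ q * cnj (b' $ q)))"
    using assms
    by (simp add: cscalar_prod_conv_sum[where n = "dim_vec a * dim_vec b"] sum_lessThan_mult
        kron_vec_index[OF refl refl] kron_vec_index[where m = "dim_vec a" and n = "dim_vec b"] mult_ac)
  then show ?thesis
    using assms by (simp add: cscalar_prod_conv_sum[OF assms(1)] cscalar_prod_conv_sum[OF assms(2)] sum_product)
qed

section \<open>Blocks of the Choi matrix and partial traces\<close>

lemma ket2_conv_unit_vec: "k < 2 \<Longrightarrow> m < 2 \<Longrightarrow> ket2 (k, m) = unit_vec 4 (2 * k + m)"
  by (rule eq_vecI) (auto simp: ket2_def kron_vec_def less_mult_imp_div_less)

lemma ket2_carrier [simp]: "ket2 \<alpha> \<in> carrier_vec 4"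
  by (simp add: ket2_def kron_vec_def)

lemma dim_ket2 [simp]: "dim_vec (ket2 \<alpha>) = 4"
  using ket2_carrier carrier_vecD by blast

lemma mem_bits2_iff: "(k, m) \<in> bits2 \<longleftrightarrow> k < 2 \<and> m < 2"
  by (auto simp: bits2_def)

lemma finite_bits2 [simp]: "finite bits2"
  by (simp add: bits2_def)

lemma ket2_index:
  assumes "\<alpha> \<in> bits2" "k < 2" "m < 2"
  shows "ket2 \<alpha> $ (2 * k + m) = (if \<alpha> = (k, m) then 1 else 0)"
proof -
  obtain k' m' where a: "\<alpha> = (k', m')" "k' < 2" "m' < 2"
    using assms(1) by (cases \<alpha>) (auto simp: mem_bits2_iff)
  have "2 * k' + m' = 2 * k + m \<longleftrightarrow> k' = k \<and> m' = m"
    using a assms by presburger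
  then show ?thesis
    using a assms by (auto simp: ket2_conv_unit_vec)
qed

lemma outer_index [simp]:
  "i < dim_vec v \<Longrightarrow> j < dim_vec w \<Longrightarrow> outer v w $$ (i, j) = v $ i * cnj (w $ j)"
  "dim_row (outer v w) = dim_vec v" "dim_col (outer v w) = dim_vec w"
  by (simp_all add: outer_def)

lemma outer_carrier [simp]: "v \<in> carrier_vec m \<Longrightarrow> w \<in> carrier_vec n \<Longrightarrow> outer v w \<in> carrier_mat m n"
  by (simp add: outer_def)

lemma kron_index:
  assumes "i < dim_row X" "i' < dim_row Y" "j < dim_col X" "j' < dim_col Y"
    and "dim_row Y = m" "dim_col Y = n"
  shows "kron X Y $$ (i * m + i', j * n + j') = X $$ (i, j) * Y $$ (i', j')"
proof -
  have "i * m + i' < dim_row X * m" "j * n + j' < dim_col X * n"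
    using assms by (simp_all add: mult_add_less_mult)
  then show ?thesis
    using assms by (simp add: kron_def)
qed

lemma dim_kron [simp]: "dim_row (kron X Y) = dim_row X * dim_row Y" "dim_col (kron X Y) = dim_col X * dim_col Y"
  by (simp_all add: kron_def)

text \<open>The input factors come last, so an index of the Choi matrix is four times an output
  index plus an input index; the kets are unit vectors, hence one summand survives.\<close>

lemma choi_index:
  assumes carrier: "\<And>X. X \<in> carrier_mat 4 4 \<Longrightarrow> \<Phi> X \<in> carrier_mat 4 4"
    and less: "s < 4" "t < 4" "k < 2" "m < 2" "k' < 2" "m' < 2"
  shows "choi \<Phi> $$ (s * 4 + (2 * k + m), t * 4 + (2 * k' + m')) = \<Phi> (outer (ket2 (k, m)) (ket2 (k', m'))) $$ (s, t)"
proof -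
  have d: "dim_row (\<Phi> (outer (ket2 \<alpha>) (ket2 \<beta>))) = 4" "dim_col (\<Phi> (outer (ket2 \<alpha>) (ket2 \<beta>))) = 4" for \<alpha> \<beta>
    by (rule carrier_matD[OF carrier[OF outer_carrier[OF ket2_carrier ket2_carrier]]])+
  have "s * 4 + (2 * k + m) < 16" "t * 4 + (2 * k' + m') < 16"
    using less by simp_all
  then have "choi \<Phi> $$ (s * 4 + (2 * k + m), t * 4 + (2 * k' + m')) =
    (\<Sum>(\<alpha>, \<beta>)\<in>bits2 \<times> bits2. kron (\<Phi> (outer (ket2 \<alpha>) (ket2 \<beta>))) (outer (ket2 \<alpha>) (ket2 \<beta>))
      $$ (s * 4 + (2 * k + m), t * 4 + (2 * k' + m')))"
    by (simp add: choi_def msum_def split_def)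
  also have "\<dots> = (\<Sum>(\<alpha>, \<beta>)\<in>bits2 \<times> bits2.
      \<Phi> (outer (ket2 \<alpha>) (ket2 \<beta>)) $$ (s, t) * (ket2 \<alpha> $ (2 * k + m) * cnj (ket2 \<beta> $ (2 * k' + m'))))"
    using less by (intro sum.cong refl) (auto simp: kron_index d)
  also have "\<dots> = (\<Sum>\<gamma>\<in>bits2 \<times> bits2. if \<gamma> = ((k, m), (k', m'))
      then \<Phi> (outer (ket2 (k, m)) (ket2 (k', m'))) $$ (s, t) else 0)"
    using less by (intro sum.cong refl) (auto simp: ket2_index split: if_splits)
  also have "\<dots> = \<Phi> (outer (ket2 (k, m)) (ket2 (k', m'))) $$ (s, t)"
    using less by (subst sum.delta) (auto simp: mem_bits2_iff)
  finally show ?thesis .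
qed

lemma four_digits:
  assumes "u < n * (4 :: nat)"
  obtains s k m where "u = s * 4 + (2 * k + m)" "s < n" "k < 2" "m < 2"
proof (rule that[of "u div 4" "u mod 4 div 2" "u mod 4 mod 2"])
  show "u = u div 4 * 4 + (2 * (u mod 4 div 2) + u mod 4 mod 2)"
    by (simp only: mult_div_mod_eq div_mult_mod_eq)
  show "u div 4 < n"
    using assms by (rule less_mult_imp_div_less)
  show "u mod 4 div 2 < 2"
    by (rule less_mult_imp_div_less) simp
qed simp

text \<open>The matrix \<open>kron swap_mat 1\<close> is the permutation matrix of an involution of
  the three-digit binary indices that exchanges the two leading digits.\<close>

lemma swap_conjugation_index:
  assumes M: "M \<in> carrier_mat 8 8"
    and less: "q < 2" "k < 2" "m < 2" "q' < 2" "k' < 2" "m' < 2"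
  shows "(kron swap_mat (1\<^sub>m 2) * M * kron swap_mat (1\<^sub>m 2)) $$ (q * 4 + (2 * k + m), q' * 4 + (2 * k' + m'))
    = M $$ (k * 4 + (2 * q + m), k' * 4 + (2 * q' + m'))"
proof -
  let ?S = "kron swap_mat (1\<^sub>m 2)"
  define \<pi> where "\<pi> s = (s div 2 mod 2) * 4 + (s div 4) * 2 + s mod 2" for s :: nat
  have digits: "(a * 4 + (2 * b + c)) div 2 div 2 = a" "(a * 4 + (2 * b + c)) div 2 mod 2 = b"
      "(a * 4 + (2 * b + c)) div 4 = a" "(a * 4 + (2 * b + c)) mod 2 = c"
    if "a < 2" "b < 2" "c < 2" for a b c :: nat
    using that by (auto simp: less_2_iff)
  have pi: "\<pi> (a * 4 + (2 * b + c)) = b * 4 + (2 * a + c)" if "a < 2" "b < 2" "c < 2" for a b c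
    using digits[OF that] unfolding \<pi>_def by simp
  \<comment> \<open>Both forms are needed: one collapses the sum over the columns of the left
    factor, the other the sum over the rows of the right factor.\<close>
  have S: "?S $$ (s, t) = (if t = \<pi> s then 1 else 0)" "?S $$ (s, t) = (if s = \<pi> t then 1 else 0)"
    if st: "s < 8" "t < 8" for s t
  proof -
    obtain a b c where s: "s = a * 4 + (2 * b + c)" "a < 2" "b < 2" "c < 2"
      using four_digits[of s 2] st(1) by auto
    obtain a' b' c' where t: "t = a' * 4 + (2 * b' + c')" "a' < 2" "b' < 2" "c' < 2"
      using four_digits[of t 2] st(2) by auto
    have e: "?S $$ (s, t) = (if a = b' \<and> b = a' \<and> c = c' then 1 else 0)"
      using st less_mult_imp_div_less[of s 4 2] less_mult_imp_div_less[of t 4 2] digits[OF s(2-4)] digits[OF t(2-4)]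
      unfolding s(1)[symmetric] t(1)[symmetric]
      by (simp add: kron_def swap_mat_def)
    have e1: "a = b' \<and> b = a' \<and> c = c' \<longleftrightarrow> t = \<pi> s"
      unfolding s(1) t(1) pi[OF s(2-4)] using s(2-4) t(2-4) by (auto simp: less_2_iff)
    have e2: "a = b' \<and> b = a' \<and> c = c' \<longleftrightarrow> s = \<pi> t"
      unfolding s(1) t(1) pi[OF t(2-4)] using s(2-4) t(2-4) by (auto simp: less_2_iff)
    show "?S $$ (s, t) = (if t = \<pi> s then 1 else 0)"
      by (simp only: e e1)
    show "?S $$ (s, t) = (if s = \<pi> t then 1 else 0)"
      by (simp only: e e2)
  qed
  define s t where "s = q * 4 + (2 * k + m)" and "t = q' * 4 + (2 * k' + m')"
  have st: "s < 8" "t < 8" using less by (simp_all add: s_def t_def)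
  have p: "\<pi> s < 8" "\<pi> t < 8" using less by (simp_all add: s_def t_def pi)
  have d: "dim_row swap_mat = 4" "dim_col swap_mat = 4" by (simp_all add: swap_mat_def)
  have "(?S * M * ?S) $$ (s, t) = (\<Sum>y<8. (\<Sum>x<8. ?S $$ (s, x) * M $$ (x, y)) * ?S $$ (y, t))"
    using M st by (simp add: scalar_prod_def d atLeast0LessThan)
  also have "\<dots> = M $$ (\<pi> s, \<pi> t)"
    using st p by (simp add: S(1)[OF st(1)] S(2)[OF _ st(2)]
        if_distrib[of "\<lambda>x. _ * x"] if_distrib[of "\<lambda>x. x * _"] cong: if_cong)
  finally show ?thesis
    using less by (simp add: s_def t_def pi)
qed

text \<open>Read block by block, non-signaling says that a partial trace over one party's output
  vanishes unless that party's two input bits agree, and that it then does not depend on their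
  common value.\<close>

lemma non_signaling_partial_traces:
  assumes carrier: "\<And>X. X \<in> carrier_mat 4 4 \<Longrightarrow> \<Phi> X \<in> carrier_mat 4 4" and ns: "non_signaling \<Phi>"
  obtains C\<^sub>A C\<^sub>B where
    "\<And>k m k' m' q q'. \<lbrakk>k < 2; m < 2; k' < 2; m' < 2; q < 2; q' < 2\<rbrakk> \<Longrightarrow>
      (\<Sum>p<2. \<Phi> (outer (ket2 (k, m)) (ket2 (k', m'))) $$ (p * 2 + q, p * 2 + q')) =
      (if k = k' then C\<^sub>B $$ (2 * q + m, 2 * q' + m') else 0)"
    "\<And>k m k' m' p p'. \<lbrakk>k < 2; m < 2; k' < 2; m' < 2; p < 2; p' < 2\<rbrakk> \<Longrightarrow>
      (\<Sum>q<2. \<Phi> (outer (ket2 (k, m)) (ket2 (k', m'))) $$ (p * 2 + q, p' * 2 + q)) =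
      (if m = m' then C\<^sub>A $$ (2 * p + k, 2 * p' + k') else 0)"
proof -
  obtain C\<^sub>A C\<^sub>B where
    CB: "C\<^sub>B \<in> carrier_mat 4 4" "ptrace 1 2 8 (choi \<Phi>) = kron swap_mat (1\<^sub>m 2) * kron (1\<^sub>m 2) C\<^sub>B * kron swap_mat (1\<^sub>m 2)" and
    CA: "C\<^sub>A \<in> carrier_mat 4 4" "ptrace 2 2 4 (choi \<Phi>) = kron C\<^sub>A (1\<^sub>m 2)"
    using ns by (auto simp: non_signaling_def positive_mat_def)
  have "(\<Sum>p<2. \<Phi> (outer (ket2 (k, m)) (ket2 (k', m'))) $$ (p * 2 + q, p * 2 + q')) =
      (if k = k' then C\<^sub>B $$ (2 * q + m, 2 * q' + m') else 0)"
    if less: "k < 2" "m < 2" "k' < 2" "m' < 2" "q < 2" "q' < 2" for k m k' m' q q'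
  proof -
    define s t where "s = q * 4 + (2 * k + m)" and "t = q' * 4 + (2 * k' + m')"
    have st: "s < 8" "t < 8" using less by (simp_all add: s_def t_def)
    have "(\<Sum>p<2. \<Phi> (outer (ket2 (k, m)) (ket2 (k', m'))) $$ (p * 2 + q, p * 2 + q'))
        = (\<Sum>p<2. choi \<Phi> $$ (p * 8 + s, p * 8 + t))"
    proof (rule sum.cong[OF refl])
      fix p :: nat assume "p \<in> {..<2}"
      then have "choi \<Phi> $$ ((p * 2 + q) * 4 + (2 * k + m), (p * 2 + q') * 4 + (2 * k' + m'))
          = \<Phi> (outer (ket2 (k, m)) (ket2 (k', m'))) $$ (p * 2 + q, p * 2 + q')"
        using less by (intro choi_index carrier) auto
      then show "\<Phi> (outer (ket2 (k, m)) (ket2 (k', m'))) $$ (p * 2 + q, p * 2 + q') = choi \<Phi> $$ (p * 8 + s, p * 8 + t)"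
        by (simp add: s_def t_def algebra_simps)
    qed
    also have "\<dots> = ptrace 1 2 8 (choi \<Phi>) $$ (s, t)"
      using st by (simp add: ptrace_def)
    also have "\<dots> = kron (1\<^sub>m 2) C\<^sub>B $$ (k * 4 + (2 * q + m), k' * 4 + (2 * q' + m'))"
      unfolding CB(2) s_def t_def using less CB(1) by (intro swap_conjugation_index) auto
    also have "\<dots> = (1\<^sub>m 2) $$ (k, k') * C\<^sub>B $$ (2 * q + m, 2 * q' + m')"
      using less CB(1) by (intro kron_index) auto
    finally show ?thesis
      using less by simp
  qed
  moreover have "(\<Sum>q<2. \<Phi> (outer (ket2 (k, m)) (ket2 (k', m'))) $$ (p * 2 + q, p' * 2 + q)) =
      (if m = m' then C\<^sub>A $$ (2 * p + k, 2 * p' + k') else 0)"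
    if less: "k < 2" "m < 2" "k' < 2" "m' < 2" "p < 2" "p' < 2" for k m k' m' p p'
  proof -
    define s t where "s = p * 4 + (2 * k + m)" and "t = p' * 4 + (2 * k' + m')"
    have st: "s < 8" "t < 8" "s div 4 = p" "t div 4 = p'" "s mod 4 = 2 * k + m" "t mod 4 = 2 * k' + m'"
      using less by (simp_all add: s_def t_def)
    have "(\<Sum>q<2. \<Phi> (outer (ket2 (k, m)) (ket2 (k', m'))) $$ (p * 2 + q, p' * 2 + q))
        = (\<Sum>q<2. choi \<Phi> $$ ((p * 2 + q) * 4 + (2 * k + m), (p' * 2 + q) * 4 + (2 * k' + m')))"
      using less by (intro sum.cong refl choi_index[symmetric] carrier) auto
    also have "\<dots> = ptrace 2 2 4 (choi \<Phi>) $$ (s, t)"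
      using st by (simp add: ptrace_def)
    also have "\<dots> = kron C\<^sub>A (1\<^sub>m 2) $$ ((2 * p + k) * 2 + m, (2 * p' + k') * 2 + m')"
      unfolding CA(2) by (simp add: s_def t_def algebra_simps)
    also have "\<dots> = C\<^sub>A $$ (2 * p + k, 2 * p' + k') * (1\<^sub>m 2) $$ (m, m')"
      using less CA(1) by (intro kron_index) auto
    finally show ?thesis
      using less by simp
  qed
  ultimately show ?thesis
    using that by blast
qed

text \<open>This is Tr Y = sum <a_i|Y|a'_i'> <a'_i'|a_i> on the first factor: the overlaps
  compensate for using different bases for rows and columns. The right-hand side is an element of
  the partial trace.\<close>

lemma sum_overlap_left:
  assumes a: "orthonormal_basis 2 a" and a': "orthonormal_basis 2 a'" and b: "dim_vec b = 2" "dim_vec b' = 2"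
  shows "(\<Sum>i<2. \<Sum>i'<2. (a i \<bullet>c a' i') * sesq X (kron_vec (a i) b) (kron_vec (a' i') b'))
    = (\<Sum>q<2. \<Sum>q'<2. cnj (b $ q) * b' $ q' * (\<Sum>r<2. X $$ (r * 2 + q, r * 2 + q')))"
proof -
  have d: "dim_vec (a l) = 2" "dim_vec (a' l) = 2" if "l < 2" for l
    using a a' that by (auto simp: orthonormal_basis_def)
  define Y where "Y q q' = mat 2 2 (\<lambda>(p, p'). X $$ (p * 2 + q, p' * 2 + q'))" for q q'
  define G where "G r q q' i i' = cnj (b $ q) * b' $ q' * (a i $ r * sesq (Y q q') (a i) (a' i') * cnj (a' i' $ r))" for r q q' i i'
  have "(\<Sum>i<2. \<Sum>i'<2. (a i \<bullet>c a' i') * sesq X (kron_vec (a i) b) (kron_vec (a' i') b'))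
      = (\<Sum>i<2. \<Sum>i'<2. \<Sum>r<2. \<Sum>q<2. \<Sum>q'<2. G r q q' i i')"
    by (intro sum.cong refl) (simp add: G_def Y_def d b cscalar_prod_conv_sum[where n = 2]
        sesq_kron_vec_left[where m = 2 and m' = 2 and n = 2 and n' = 2] sum_lessThan_2 algebra_simps)
  also have "\<dots> = (\<Sum>q<2. \<Sum>q'<2. \<Sum>r<2. \<Sum>i<2. \<Sum>i'<2. G r q q' i i')"
    by (simp add: sum_lessThan_2 add_ac)
  also have "\<dots> = (\<Sum>q<2. \<Sum>q'<2. cnj (b $ q) * b' $ q' * (\<Sum>r<2. X $$ (r * 2 + q, r * 2 + q')))"
  proof (intro sum.cong refl)
    fix q q' :: nat
    have "(\<Sum>i<2. \<Sum>i'<2. a i $ r * sesq (Y q q') (a i) (a' i') * cnj (a' i' $ r)) = X $$ (r * 2 + q, r * 2 + q')"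
      if "r < 2" for r
      using that by (subst complete_sesq[where m = 2 and n = 2])
        (auto simp: orthonormal_basis_complete[OF a] orthonormal_basis_complete[OF a'] d Y_def)
    then show "(\<Sum>r<2. \<Sum>i<2. \<Sum>i'<2. G r q q' i i') = cnj (b $ q) * b' $ q' * (\<Sum>r<2. X $$ (r * 2 + q, r * 2 + q'))"
      unfolding G_def by (simp flip: sum_distrib_left)
  qed
  finally show ?thesis .
qed

lemma sum_overlap_right:
  assumes b: "orthonormal_basis 2 b" and b': "orthonormal_basis 2 b'" and a: "dim_vec a = 2" "dim_vec a' = 2"
  shows "(\<Sum>j<2. \<Sum>j'<2. (b j \<bullet>c b' j') * sesq X (kron_vec a (b j)) (kron_vec a' (b' j')))
    = (\<Sum>p<2. \<Sum>p'<2. cnj (a $ p) * a' $ p' * (\<Sum>r<2. X $$ (p * 2 + r, p' * 2 + r)))"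
proof -
  have d: "dim_vec (b l) = 2" "dim_vec (b' l) = 2" if "l < 2" for l
    using b b' that by (auto simp: orthonormal_basis_def)
  define Y where "Y p p' = mat 2 2 (\<lambda>(q, q'). X $$ (p * 2 + q, p' * 2 + q'))" for p p'
  define G where "G r p p' j j' = cnj (a $ p) * a' $ p' * (b j $ r * sesq (Y p p') (b j) (b' j') * cnj (b' j' $ r))" for r p p' j j'
  have "(\<Sum>j<2. \<Sum>j'<2. (b j \<bullet>c b' j') * sesq X (kron_vec a (b j)) (kron_vec a' (b' j')))
      = (\<Sum>j<2. \<Sum>j'<2. \<Sum>r<2. \<Sum>p<2. \<Sum>p'<2. G r p p' j j')"
    by (intro sum.cong refl) (simp add: G_def Y_def d a cscalar_prod_conv_sum[where n = 2]
        sesq_kron_vec_right[where m = 2 and m' = 2 and n = 2 and n' = 2] sum_lessThan_2 algebra_simps)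
  also have "\<dots> = (\<Sum>p<2. \<Sum>p'<2. \<Sum>r<2. \<Sum>j<2. \<Sum>j'<2. G r p p' j j')"
    by (simp add: sum_lessThan_2 add_ac)
  also have "\<dots> = (\<Sum>p<2. \<Sum>p'<2. cnj (a $ p) * a' $ p' * (\<Sum>r<2. X $$ (p * 2 + r, p' * 2 + r)))"
  proof (intro sum.cong refl)
    fix p p' :: nat
    have "(\<Sum>j<2. \<Sum>j'<2. b j $ r * sesq (Y p p') (b j) (b' j') * cnj (b' j' $ r)) = X $$ (p * 2 + r, p' * 2 + r)"
      if "r < 2" for r
      using that by (subst complete_sesq[where m = 2 and n = 2])
        (auto simp: orthonormal_basis_complete[OF b] orthonormal_basis_complete[OF b'] d Y_def)
    then show "(\<Sum>r<2. \<Sum>j<2. \<Sum>j'<2. G r p p' j j') = cnj (a $ p) * a' $ p' * (\<Sum>r<2. X $$ (p * 2 + r, p' * 2 + r))"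
      unfolding G_def by (simp flip: sum_distrib_left)
  qed
  finally show ?thesis .
qed

lemma mtrace_outer_mult:
  assumes "X \<in> carrier_mat n n" "w \<in> carrier_vec n"
  shows "mtrace (outer w w * X) = sesq X w w"
proof -
  have "mtrace (outer w w * X) = (\<Sum>s<n. \<Sum>t<n. cnj (w $ t) * X $$ (t, s) * w $ s)"
    using assms by (simp add: mtrace_def scalar_prod_def outer_def atLeast0LessThan mult_ac)
  also have "\<dots> = sesq X w w"
    using assms by (subst sum.swap) (simp add: sesq_def)
  finally show ?thesis .
qed

section \<open>Support of the blocks of a PR-channel\<close>

lemma sum_eq_single:
  assumes "finite A" "p \<in> A" "\<And>x. x \<in> A \<Longrightarrow> x \<noteq> p \<Longrightarrow> f x = 0"
  shows "sum f A = f p"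
  using assms by (subst sum.remove[of A p]) auto

lemma orthogonality_flip:
  assumes "orthogonality Z" "k < 2" "k' < 2" "i < 2" "i' < 2" "Z k i k' i'"
  shows "Z k (1 - i) k' (1 - i')"
  using assms unfolding orthogonality_def by blast

lemma linked_sym:
  assumes "orthogonality ZA" "orthogonality ZB" "\<alpha> \<in> bits2" "\<beta> \<in> bits2" "linked ZA ZB \<alpha> \<beta>"
  shows "linked ZA ZB \<beta> \<alpha>"
proof -
  have sym: "Z k' i' k i" if "orthogonality Z" "Z k i k' i'" "k < 2" "k' < 2" "i < 2" "i' < 2" for Z k i k' i'
    using that unfolding orthogonality_def by blast
  obtain k m k' m' where a: "\<alpha> = (k, m)" "\<beta> = (k', m')" "k < 2" "m < 2" "k' < 2" "m' < 2"
    using assms(3,4) by (cases \<alpha>, cases \<beta>) (auto simp: mem_bits2_iff)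
  obtain i i' where i: "i < 2" "i' < 2" "ZA k i k' i'" "ZB m (partner k m i) m' (partner k' m' i')"
    using assms(5) by (auto simp: linked_def a)
  then show ?thesis
    unfolding linked_def a fst_conv snd_conv
    using sym[OF assms(1) i(3)] sym[OF assms(2) i(4)] a partner_less by blast
qed

section \<open>A fixed PR-channel and the matrix elements of its blocks\<close>

locale pr_channel =
  fixes \<Phi> :: "complex mat \<Rightarrow> complex mat" and \<eta>\<^sub>A \<eta>\<^sub>B :: "nat \<Rightarrow> complex vec"
  assumes basis_A: "orthonormal_basis 2 \<eta>\<^sub>A" and basis_B: "orthonormal_basis 2 \<eta>\<^sub>B"
    and PR: "PR_channel \<eta>\<^sub>A \<eta>\<^sub>B \<Phi>"
begin

text \<open>Alice's input bit also names her setting: the input |k> always goes with a measurement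
  in the basis \<open>a k\<close>.\<close>

definition a :: "nat \<Rightarrow> nat \<Rightarrow> complex vec" where
  "a k = (if k = 0 then unit_vec 2 else \<eta>\<^sub>A)"

definition b :: "nat \<Rightarrow> nat \<Rightarrow> complex vec" where
  "b m = (if m = 0 then unit_vec 2 else \<eta>\<^sub>B)"

abbreviation block :: "nat \<times> nat \<Rightarrow> nat \<times> nat \<Rightarrow> complex mat" where
  "block \<alpha> \<beta> \<equiv> \<Phi> (outer (ket2 \<alpha>) (ket2 \<beta>))"

text \<open>Rows are taken in the product basis that belongs to the input (k, m), columns in the one
  that belongs to (k', m').\<close>

definition matrix_elem :: "nat \<Rightarrow> nat \<Rightarrow> nat \<Rightarrow> nat \<Rightarrow> nat \<Rightarrow> nat \<Rightarrow> nat \<Rightarrow> nat \<Rightarrow> complex" where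
  "matrix_elem k m k' m' i j i' j' =
    sesq (block (k, m) (k', m')) (kron_vec (a k i) (b m j)) (kron_vec (a k' i') (b m' j'))"

abbreviation link :: "nat \<times> nat \<Rightarrow> nat \<times> nat \<Rightarrow> bool" where
  "link \<equiv> linked (\<lambda>k i k' i'. a k i \<bullet>c a k' i' = 0) (\<lambda>m j m' j'. b m j \<bullet>c b m' j' = 0)"

lemma basis_a: "orthonormal_basis 2 (a k)" and basis_b: "orthonormal_basis 2 (b m)"
  by (simp_all add: a_def b_def basis_A basis_B orthonormal_basis_unit_vec)

lemma dim_a: "i < 2 \<Longrightarrow> dim_vec (a k i) = 2" and dim_b: "i < 2 \<Longrightarrow> dim_vec (b k i) = 2"
  using basis_a[of k] basis_b[of k] by (auto simp: orthonormal_basis_def)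

lemma orthonormal_a: "i < 2 \<Longrightarrow> j < 2 \<Longrightarrow> a k i \<bullet>c a k j = (if i = j then 1 else 0)"
  and orthonormal_b: "i < 2 \<Longrightarrow> j < 2 \<Longrightarrow> b k i \<bullet>c b k j = (if i = j then 1 else 0)"
  using basis_a[of k] basis_b[of k] by (auto simp: orthonormal_basis_def)

lemma orthogonality_a: "orthogonality (\<lambda>k i k' i'. a k i \<bullet>c a k' i' = 0)"
  and orthogonality_b: "orthogonality (\<lambda>k i k' i'. b k i \<bullet>c b k' i' = 0)"
  by (intro orthogonality_orthonormal_bases basis_a basis_b)+

lemma channel_carrier: "X \<in> carrier_mat 4 4 \<Longrightarrow> \<Phi> X \<in> carrier_mat 4 4"
  using PR by (auto simp: PR_channel_def channel_def linear_superop_def)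

lemma block_carrier: "block \<alpha> \<beta> \<in> carrier_mat 4 4"
  by (intro channel_carrier outer_carrier ket2_carrier)

lemma cauchy_schwarz:
  assumes "v \<in> carrier_vec 4" "w \<in> carrier_vec 4"
  shows "sesq (block \<beta> \<alpha>) w v = cnj (sesq (block \<alpha> \<beta>) v w)"
    and "(cmod (sesq (block \<alpha> \<beta>) v w))\<^sup>2 \<le> Re (sesq (block \<alpha> \<alpha>) v v) * Re (sesq (block \<beta> \<beta>) w w)"
  using completely_positive_sesq_cauchy_schwarz[of 4 4 \<Phi> "ket2 \<alpha>" "ket2 \<beta>" v w] assms PR
  by (auto simp: PR_channel_def channel_def)

lemma out_carrier: "i < 2 \<Longrightarrow> j < 2 \<Longrightarrow> kron_vec (a k i) (b m j) \<in> carrier_vec 4"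
  by (rule carrier_vecI) (simp add: dim_a dim_b)

text \<open>By the Born rule these elements are exactly the joint probabilities of the PR-box;
  \<open>c\<close> and \<open>e\<close> translate bits into settings and outcomes.\<close>

lemma matrix_elem_diag:
  assumes "k < 2" "m < 2" "i < 2" "j < 2"
  shows "matrix_elem k m k m i j i j = (if j = partner k m i then 1 / 2 else 0)"
proof -
  define c where "c k = (if k = 0 then Unprimed else Primed)" for k :: nat
  define e where "e i = (if i = 0 then 1 else - 1 :: int)" for i :: nat
  have m: "max_incompatible \<eta>\<^sub>A (c k) = (unit_vec 2 k, a k)" "max_incompatible \<eta>\<^sub>B (c m) = (unit_vec 2 m, b m)"
    using assms by (auto simp: less_2_iff c_def a_def b_def)
  have o: "outcome_index (e i) = i" "outcome_index (e j) = j"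
    using assms by (auto simp: less_2_iff outcome_index_def e_def)
  have mem: "e i \<in> {1, -1}" "e j \<in> {1, -1}"
    by (auto simp: e_def)
  have "matrix_elem k m k m i j i j = joint_prob \<Phi> (e i) (e j) (max_incompatible \<eta>\<^sub>A (c k)) (max_incompatible \<eta>\<^sub>B (c m))"
    unfolding joint_prob_def Let_def m fst_conv snd_conv o matrix_elem_def
    using mtrace_outer_mult[OF block_carrier[of "(k, m)" "(k, m)"] out_carrier[OF assms(3,4), of k m]]
    by (simp add: ket2_def)
  also have "\<dots> = (if ((c k, c m) \<noteq> (Primed, Primed) \<and> e i * e j = 1) \<or> ((c k, c m) = (Primed, Primed) \<and> e i * e j = -1)
           then 1 / 2 else 0)"
    using PR mem unfolding PR_channel_def by blast
  also have "\<dots> = (if j = partner k m i then 1 / 2 else 0)"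
    using assms by (auto simp: less_2_iff c_def e_def partner_def)
  finally show ?thesis .
qed

text \<open>The squared modulus is bounded by the product of two joint probabilities, one of which
  is zero for a forbidden pair of outcomes.\<close>

lemma matrix_elem_support:
  assumes less: "k < 2" "m < 2" "k' < 2" "m' < 2" "i < 2" "j < 2" "i' < 2" "j' < 2"
    and nz: "matrix_elem k m k' m' i j i' j' \<noteq> 0"
  shows "j = partner k m i \<and> j' = partner k' m' i'"
proof (rule ccontr)
  assume "\<not> (j = partner k m i \<and> j' = partner k' m' i')"
  then have "matrix_elem k m k m i j i j = 0 \<or> matrix_elem k' m' k' m' i' j' i' j' = 0"
    using less by (auto simp: matrix_elem_diag)
  then have "(cmod (matrix_elem k m k' m' i j i' j'))\<^sup>2 \<le> 0"
    using cauchy_schwarz(2)[OF out_carrier out_carrier, of i j i' j' "(k, m)" "(k', m')" k m k' m'] less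
    unfolding matrix_elem_def[symmetric] by auto
  with nz show False by simp
qed

lemma matrix_elem_overlap:
  assumes "k < 2" "m < 2" "k' < 2" "m' < 2" "i < 2" "j < 2" "i' < 2" "j' < 2"
    and "(k, m) \<noteq> (k', m')" and "matrix_elem k m k' m' i j i' j' \<noteq> 0"
  shows "a k i \<bullet>c a k' i' = 0 \<and> b m j \<bullet>c b m' j' = 0"
proof (rule non_signaling_partial_traces[OF channel_carrier])
  show "non_signaling \<Phi>"
    using PR by (simp add: PR_channel_def)
next
  fix C\<^sub>A C\<^sub>B
  assume
    CB: "\<And>k m k' m' q q'. \<lbrakk>k < 2; m < 2; k' < 2; m' < 2; q < 2; q' < 2\<rbrakk> \<Longrightarrow>
      (\<Sum>p<2. block (k, m) (k', m') $$ (p * 2 + q, p * 2 + q')) =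
      (if k = k' then C\<^sub>B $$ (2 * q + m, 2 * q' + m') else 0)"
    and CA: "\<And>k m k' m' p p'. \<lbrakk>k < 2; m < 2; k' < 2; m' < 2; p < 2; p' < 2\<rbrakk> \<Longrightarrow>
      (\<Sum>q<2. block (k, m) (k', m') $$ (p * 2 + q, p' * 2 + q)) =
      (if m = m' then C\<^sub>A $$ (2 * p + k, 2 * p' + k') else 0)"
  \<comment> \<open>These are the matrix elements of \<open>C\<^sub>B\<close> and
    \<open>C\<^sub>A\<close> in the product bases of the remaining party, the common values of the
    marginals.\<close>
  define hB where "hB m j m' j' = (\<Sum>q<2. \<Sum>q'<2. cnj (b m j $ q) * b m' j' $ q' * C\<^sub>B $$ (2 * q + m, 2 * q' + m'))" for m j m' j'
  define hA where "hA k i k' i' = (\<Sum>p<2. \<Sum>p'<2. cnj (a k i $ p) * a k' i' $ p' * C\<^sub>A $$ (2 * p + k, 2 * p' + k'))" for k i k' i'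
  have nsA: "(\<Sum>i<2. \<Sum>i'<2. (a k i \<bullet>c a k' i') * matrix_elem k m k' m' i j i' j') = (if k = k' then hB m j m' j' else 0)"
    if "k < 2" "m < 2" "k' < 2" "m' < 2" "j < 2" "j' < 2" for k m k' m' j j'
    unfolding matrix_elem_def using that
    by (simp add: sum_overlap_left basis_a dim_b CB hB_def)
  have nsB: "(\<Sum>j<2. \<Sum>j'<2. (b m j \<bullet>c b m' j') * matrix_elem k m k' m' i j i' j') = (if m = m' then hA k i k' i' else 0)"
    if "k < 2" "m < 2" "k' < 2" "m' < 2" "i < 2" "i' < 2" for k m k' m' i i'
    unfolding matrix_elem_def using that
    by (simp add: sum_overlap_right basis_b dim_a CA hA_def)
  show ?thesis
    by (rule overlap_zero[where F = matrix_elem and ovA = "\<lambda>k i k' i'. a k i \<bullet>c a k' i'"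
          and ovB = "\<lambda>m j m' j'. b m j \<bullet>c b m' j'" and hA = hA and hB = hB])
       (assumption | rule matrix_elem_support orthonormal_a orthonormal_b nsA nsB assms)+
qed

text \<open>Up to the factor \<open>1/2\<close> and coherences, \<open>\<Phi>(|\<alpha>\<rangle>\<langle>\<alpha>|)\<close> is the projection onto the span of
  \<open>supp_vec \<alpha> 0\<close> and \<open>supp_vec \<alpha> 1\<close>.\<close>

definition supp_vec :: "nat \<times> nat \<Rightarrow> nat \<Rightarrow> complex vec" where
  "supp_vec \<alpha> i = kron_vec (a (fst \<alpha>) i) (b (snd \<alpha>) (partner (fst \<alpha>) (snd \<alpha>) i))"

lemma supp_vec_carrier: "i < 2 \<Longrightarrow> supp_vec \<alpha> i \<in> carrier_vec 4"
  by (simp add: supp_vec_def out_carrier)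

lemma dim_supp_vec [simp]: "i < 2 \<Longrightarrow> dim_vec (supp_vec \<alpha> i) = 4"
  using supp_vec_carrier carrier_vecD by blast

lemma supp_vec_orthonormal: "i < 2 \<Longrightarrow> j < 2 \<Longrightarrow> supp_vec \<alpha> i \<bullet>c supp_vec \<alpha> j = (if i = j then 1 else 0)"
  by (simp add: supp_vec_def cscalar_prod_kron_vec dim_a dim_b orthonormal_a orthonormal_b)

lemma block_supp_vec_diag: "\<alpha> \<in> bits2 \<Longrightarrow> i < 2 \<Longrightarrow> sesq (block \<alpha> \<alpha>) (supp_vec \<alpha> i) (supp_vec \<alpha> i) = 1 / 2"
  using matrix_elem_diag[of "fst \<alpha>" "snd \<alpha>" i "partner (fst \<alpha>) (snd \<alpha>) i"]
  by (cases \<alpha>) (simp add: matrix_elem_def supp_vec_def mem_bits2_iff)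

text \<open>In the expansion over both product bases, every term with a forbidden pair of outcomes
  drops out, which leaves two vectors on each side.\<close>

lemma block_supp_vec:
  assumes "\<alpha> \<in> bits2" "\<beta> \<in> bits2" and st: "s < 4" "t < 4"
  shows "block \<alpha> \<beta> $$ (s, t) =
    (\<Sum>i<2. \<Sum>j<2. supp_vec \<alpha> i $ s * sesq (block \<alpha> \<beta>) (supp_vec \<alpha> i) (supp_vec \<beta> j) * cnj (supp_vec \<beta> j $ t))"
proof -
  obtain k m k' m' where kl: "\<alpha> = (k, m)" "\<beta> = (k', m')" "k < 2" "m < 2" "k' < 2" "m' < 2"
    using assms by (cases \<alpha>, cases \<beta>) (auto simp: mem_bits2_iff)
  define T where "T i j i' j' = kron_vec (a k i) (b m j) $ s * matrix_elem k m k' m' i j i' j'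
    * cnj (kron_vec (a k' i') (b m' j') $ t)" for i j i' j'
  have T0: "T i j i' j' = 0" if "j \<noteq> partner k m i \<or> j' \<noteq> partner k' m' i'" "i < 2" "j < 2" "i' < 2" "j' < 2" for i j i' j'
    using matrix_elem_support[OF kl(3-6) that(2-5)] that(1) by (auto simp: T_def)
  have "block \<alpha> \<beta> $$ (s, t) = (\<Sum>x\<in>{..<2} \<times> {..<2}. \<Sum>y\<in>{..<2} \<times> {..<2}.
      (case x of (i, j) \<Rightarrow> kron_vec (a k i) (b m j)) $ s
      * sesq (block \<alpha> \<beta>) (case x of (i, j) \<Rightarrow> kron_vec (a k i) (b m j)) (case y of (i, j) \<Rightarrow> kron_vec (a k' i) (b m' j))
      * cnj ((case y of (i, j) \<Rightarrow> kron_vec (a k' i) (b m' j)) $ t))"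
    using kron_vec_complete[OF basis_a basis_b, of _ _ k m] kron_vec_complete[OF basis_a basis_b, of _ _ k' m'] st
    by (intro complete_sesq[symmetric, where m = 4 and n = 4]) (auto simp: split_def dim_a dim_b)
  also have "\<dots> = (\<Sum>i<2. \<Sum>j<2. \<Sum>i'<2. \<Sum>j'<2. T i j i' j')"
    by (simp add: sum.cartesian_product' T_def matrix_elem_def kl)
  also have "\<dots> = (\<Sum>i<2. \<Sum>i'<2. T i (partner k m i) i' (partner k' m' i'))"
  proof (rule sum.cong[OF refl])
    fix i :: nat assume "i \<in> {..<2}"
    then have i: "i < 2" by simp
    have "(\<Sum>j<2. \<Sum>i'<2. \<Sum>j'<2. T i j i' j') = (\<Sum>i'<2. \<Sum>j'<2. T i (partner k m i) i' j')"
      using i by (intro sum_eq_single) (auto intro!: sum.neutral T0)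
    also have "\<dots> = (\<Sum>i'<2. T i (partner k m i) i' (partner k' m' i'))"
      using i by (intro sum.cong refl sum_eq_single) (auto intro!: T0)
    finally show "(\<Sum>j<2. \<Sum>i'<2. \<Sum>j'<2. T i j i' j') = (\<Sum>i'<2. T i (partner k m i) i' (partner k' m' i'))" .
  qed
  finally show ?thesis
    by (simp add: T_def matrix_elem_def supp_vec_def kl)
qed

lemma block_offdiag:
  assumes "\<alpha> \<in> bits2" "\<beta> \<in> bits2" "\<alpha> \<noteq> \<beta>" "i < 2" "j < 2"
    and nz: "sesq (block \<alpha> \<beta>) (supp_vec \<alpha> i) (supp_vec \<beta> j) \<noteq> 0"
  shows "link \<alpha> \<beta>" and "supp_vec \<alpha> i \<bullet>c supp_vec \<beta> j = 0"
proof -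
  obtain k m k' m' where kl: "\<alpha> = (k, m)" "\<beta> = (k', m')" "k < 2" "m < 2" "k' < 2" "m' < 2"
    using assms by (cases \<alpha>, cases \<beta>) (auto simp: mem_bits2_iff)
  have z: "a k i \<bullet>c a k' j = 0 \<and> b m (partner k m i) \<bullet>c b m' (partner k' m' j) = 0"
    using nz assms(3-5) kl unfolding supp_vec_def
    by (intro matrix_elem_overlap) (auto simp: matrix_elem_def)
  then show "link \<alpha> \<beta>"
    using assms(4,5) by (auto simp: linked_def kl)
  show "supp_vec \<alpha> i \<bullet>c supp_vec \<beta> j = 0"
    using z assms(4,5) by (simp add: supp_vec_def kl cscalar_prod_kron_vec dim_a dim_b)
qed

text \<open>Flipping both indices turns one orthogonal pair into a second one in each factor, and in
  dimension two each such pair yields a parallel pair; the phases of the two factors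
  multiply.\<close>

lemma link_supp_vec:
  assumes "\<alpha> \<in> bits2" "\<beta> \<in> bits2" "link \<alpha> \<beta>"
  obtains p :: "nat \<Rightarrow> nat" and c where "p = id \<or> p = (\<lambda>i. 1 - i)" "\<And>i. i < 2 \<Longrightarrow> c i * cnj (c i) = 1" "\<And>i. i < 2 \<Longrightarrow> supp_vec \<beta> i = c i \<cdot>\<^sub>v supp_vec \<alpha> (p i)"
proof -
  obtain k m k' m' where kl: "\<alpha> = (k, m)" "\<beta> = (k', m')" "k < 2" "m < 2" "k' < 2" "m' < 2"
    using assms by (cases \<alpha>, cases \<beta>) (auto simp: mem_bits2_iff)
  obtain i i' where i: "i < 2" "i' < 2" and zA: "a k i \<bullet>c a k' i' = 0"
    and zB: "b m (partner k m i) \<bullet>c b m' (partner k' m' i') = 0"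
    using assms(3) by (auto simp: linked_def kl)
  have zA': "a k (1 - i) \<bullet>c a k' (1 - i') = 0"
    using orthogonality_flip[OF orthogonality_a, of k k' i i'] zA kl i by simp
  have zB': "b m (1 - partner k m i) \<bullet>c b m' (1 - partner k' m' i') = 0"
    using orthogonality_flip[OF orthogonality_b, of m m' "partner k m i" "partner k' m' i'"] zB kl i by simp
  have parallel: "\<exists>c. c * cnj c = 1 \<and> supp_vec \<beta> j' = c \<cdot>\<^sub>v supp_vec \<alpha> (1 - j)"
    if jj: "j < 2" "j' < 2" "a k j \<bullet>c a k' j' = 0" "b m (partner k m j) \<bullet>c b m' (partner k' m' j') = 0" for j j'
  proof -
    obtain c where c: "c * cnj c = 1" "a k' j' = c \<cdot>\<^sub>v a k (1 - j)"
      using orthogonal_parallel[OF basis_a basis_a jj(1-3)] by blast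
    obtain d where d: "d * cnj d = 1" "b m' (partner k' m' j') = d \<cdot>\<^sub>v b m (1 - partner k m j)"
      using orthogonal_parallel[OF basis_b basis_b _ _ jj(4)] jj(1,2) by auto
    have "(c * d) * cnj (c * d) = (c * cnj c) * (d * cnj d)" by simp
    then have "(c * d) * cnj (c * d) = 1" using c(1) d(1) by simp
    moreover have "supp_vec \<beta> j' = (c * d) \<cdot>\<^sub>v supp_vec \<alpha> (1 - j)"
      using jj(1,2) by (simp only: supp_vec_def kl fst_conv snd_conv c(2) d(2) kron_vec_smult partner_flip)
    ultimately show ?thesis by blast
  qed
  obtain c where c: "c * cnj c = 1" "supp_vec \<beta> i' = c \<cdot>\<^sub>v supp_vec \<alpha> (1 - i)"
    using parallel[OF i zA zB] by blast
  obtain d where d: "d * cnj d = 1" "supp_vec \<beta> (1 - i') = d \<cdot>\<^sub>v supp_vec \<alpha> (1 - (1 - i))"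
    using parallel[OF less_2_flip(2) less_2_flip(2) zA'] zB' unfolding partner_flip[OF i(1)] partner_flip[OF i(2)]
    by blast
  define e where "e j = (if j = i' then c else d)" for j
  \<comment> \<open>Vector \<open>i'\<close> of \<open>\<beta>\<close> is parallel to vector
    \<open>1 - i\<close> of \<open>\<alpha>\<close>; this is the flip if \<open>i = i'\<close> and
    the identity otherwise.\<close>
  define p :: "nat \<Rightarrow> nat" where "p = (if i = i' then (\<lambda>i. 1 - i) else id)"
  show ?thesis
  proof (rule that[of p e])
    show "p = id \<or> p = (\<lambda>i. 1 - i)" by (simp add: p_def)
    show "e j * cnj (e j) = 1" if "j < 2" for j using c d by (simp add: e_def)
    show "supp_vec \<beta> j = e j \<cdot>\<^sub>v supp_vec \<alpha> (p j)" if "j < 2" for j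
      using c(2) d(2) i that by (auto simp: less_2_iff e_def p_def)
  qed
qed

end

section \<open>Entries of the normal form\<close>

lemma mat_adjoint_index [simp]:
  "i < dim_col A \<Longrightarrow> j < dim_row A \<Longrightarrow> mat_adjoint A $$ (i, j) = cnj (A $$ (j, i))"
  "dim_row (mat_adjoint A) = dim_col A" "dim_col (mat_adjoint A) = dim_row A"
  by (simp_all add: mat_adjoint_def mat_of_rows_def)

lemma conj_index:
  assumes "V \<in> carrier_mat d e" "B \<in> carrier_mat e f" "W \<in> carrier_mat d' f" "s < d" "t < d'"
  shows "(V * B * mat_adjoint W) $$ (s, t) = (\<Sum>i<e. \<Sum>j<f. V $$ (s, i) * B $$ (i, j) * cnj (W $$ (t, j)))"
proof -
  have "(V * B * mat_adjoint W) $$ (s, t) = (\<Sum>j<f. \<Sum>i<e. V $$ (s, i) * B $$ (i, j) * cnj (W $$ (t, j)))"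
    using assms by (simp add: scalar_prod_def atLeast0LessThan sum_distrib_right)
  then show ?thesis
    by (simp only: sum.swap[of _ "{..<f}"])
qed

lemma mat_adjoint_kron: "kron (mat_adjoint V) (mat_adjoint W) = mat_adjoint (kron V W)"
proof (rule eq_matI)
  fix i j assume "i < dim_row (mat_adjoint (kron V W))" "j < dim_col (mat_adjoint (kron V W))"
  then have ij: "i < dim_col V * dim_col W" "j < dim_row V * dim_row W"
    by simp_all
  have pos: "0 < dim_col W" "0 < dim_row W"
    using ij by (metis mult_0_right not_gr_zero not_less_zero)+
  show "kron (mat_adjoint V) (mat_adjoint W) $$ (i, j) = mat_adjoint (kron V W) $$ (i, j)"
    using ij pos by (simp add: kron_def less_mult_imp_div_less)
qed simp_all

lemma kron_conj_index:
  assumes "V \<in> carrier_mat d e" "W \<in> carrier_mat f r" "B \<in> carrier_mat (e * r) (e * r)"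
    and "s < d" "t < d" "n < f" "n' < f"
  shows "(kron V W * B * kron (mat_adjoint V) (mat_adjoint W)) $$ (s * f + n, t * f + n')
    = (\<Sum>p<r. \<Sum>q<r. W $$ (n, p) * cnj (W $$ (n', q)) *
        (\<Sum>i<e. \<Sum>j<e. V $$ (s, i) * B $$ (i * r + p, j * r + q) * cnj (V $$ (t, j))))"
proof -
  have K: "kron V W \<in> carrier_mat (d * f) (e * r)"
    using assms by (intro carrier_matI) auto
  have lt: "s * f + n < d * f" "t * f + n' < d * f"
    using assms by (simp_all add: mult_add_less_mult)
  have "(kron V W * B * kron (mat_adjoint V) (mat_adjoint W)) $$ (s * f + n, t * f + n')
      = (\<Sum>i<e. \<Sum>p<r. \<Sum>j<e. \<Sum>q<r. kron V W $$ (s * f + n, i * r + p) * B $$ (i * r + p, j * r + q)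
          * cnj (kron V W $$ (t * f + n', j * r + q)))"
    unfolding mat_adjoint_kron conj_index[OF K assms(3) K lt] sum_lessThan_mult ..
  also have "\<dots> = (\<Sum>i<e. \<Sum>p<r. \<Sum>j<e. \<Sum>q<r. W $$ (n, p) * cnj (W $$ (n', q)) *
        (V $$ (s, i) * B $$ (i * r + p, j * r + q) * cnj (V $$ (t, j))))"
  proof (intro sum.cong refl)
    fix i p j q assume "i \<in> {..<e}" "p \<in> {..<r}" "j \<in> {..<e}" "q \<in> {..<r}"
    then have "kron V W $$ (s * f + n, i * r + p) = V $$ (s, i) * W $$ (n, p)"
      "kron V W $$ (t * f + n', j * r + q) = V $$ (t, j) * W $$ (n', q)"
      using assms by (auto intro!: kron_index)
    then show "kron V W $$ (s * f + n, i * r + p) * B $$ (i * r + p, j * r + q) * cnj (kron V W $$ (t * f + n', j * r + q))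
      = W $$ (n, p) * cnj (W $$ (n', q)) * (V $$ (s, i) * B $$ (i * r + p, j * r + q) * cnj (V $$ (t, j)))"
      by simp
  qed
  also have "\<dots> = (\<Sum>p<r. \<Sum>i<e. \<Sum>q<r. \<Sum>j<e. W $$ (n, p) * cnj (W $$ (n', q)) *
        (V $$ (s, i) * B $$ (i * r + p, j * r + q) * cnj (V $$ (t, j))))"
    by (subst sum.swap, rule sum.cong[OF refl], rule sum.cong[OF refl], rule sum.swap)
  also have "\<dots> = (\<Sum>p<r. \<Sum>q<r. \<Sum>i<e. \<Sum>j<e. W $$ (n, p) * cnj (W $$ (n', q)) *
        (V $$ (s, i) * B $$ (i * r + p, j * r + q) * cnj (V $$ (t, j))))"
    by (rule sum.cong[OF refl], rule sum.swap)
  finally show ?thesis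
    by (simp add: sum_distrib_left)
qed

lemma dim_B [simp]: "dim_row (B_diag z) = 2" "dim_col (B_diag z) = 2" "dim_row (B_off x y) = 2" "dim_col (B_off x y) = 2"
  by (simp_all add: B_diag_def B_off_def mat_of_rows_list_def)

lemma B_diag_carrier: "B_diag z \<in> carrier_mat 2 2"
  by (simp add: carrier_matI)

lemma B_diag_index: "B_diag z $$ (0, 0) = 1" "B_diag z $$ (0, Suc 0) = z" "B_diag z $$ (Suc 0, 0) = cnj z" "B_diag z $$ (Suc 0, Suc 0) = 1"
  by (simp_all add: B_diag_def mat_of_rows_list_def)

lemma B_off_index: "B_off x y $$ (0, 0) = 0" "B_off x y $$ (0, Suc 0) = x" "B_off x y $$ (Suc 0, 0) = y" "B_off x y $$ (Suc 0, Suc 0) = 0"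
  by (simp_all add: B_off_def mat_of_rows_list_def)

lemma B_block_carrier: "B_block r z x y \<in> carrier_mat (2 * r) (2 * r)"
  by (simp add: B_block_def msum_def)

lemma B_block_index:
  assumes "i < 2" "j < 2" "p < r" "q < r"
  shows "B_block r z x y $$ (i * r + p, j * r + q) =
    1 / 2 * (if p = q then B_diag (z p) $$ (i, j) else B_off (x p q) (y p q) $$ (i, j))"
proof -
  have lt: "i * r + p < 2 * r" "j * r + q < 2 * r"
    using assms by (simp_all add: mult_add_less_mult)
  have k: "kron M (outer (unit_vec r p') (unit_vec r q')) $$ (i * r + p, j * r + q)
      = M $$ (i, j) * (if p = p' \<and> q = q' then 1 else 0)"
    if "M \<in> carrier_mat 2 2" "p' < r" "q' < r" for M p' q'
  proof -
    have "kron M (outer (unit_vec r p') (unit_vec r q')) $$ (i * r + p, j * r + q)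
      = M $$ (i, j) * outer (unit_vec r p') (unit_vec r q') $$ (p, q)"
      using assms that by (intro kron_index) auto
    then show ?thesis
      using assms that by (auto simp: outer_def)
  qed
  have "(\<Sum>p'<r. kron (B_diag (z p')) (outer (unit_vec r p') (unit_vec r p')) $$ (i * r + p, j * r + q))
      = (\<Sum>p'<r. if p' = p then (if p = q then B_diag (z p) $$ (i, j) else 0) else 0)"
    by (intro sum.cong refl) (auto simp: k B_diag_carrier)
  also have "\<dots> = (if p = q then B_diag (z p) $$ (i, j) else 0)"
    using assms by simp
  finally have d: "(\<Sum>p'<r. kron (B_diag (z p')) (outer (unit_vec r p') (unit_vec r p')) $$ (i * r + p, j * r + q))
      = (if p = q then B_diag (z p) $$ (i, j) else 0)" .
  define S where "S = {(p, q). p < r \<and> q < r \<and> p \<noteq> q}"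
  have "S \<subseteq> {..<r} \<times> {..<r}" by (auto simp: S_def)
  then have fin: "finite S" by (rule finite_subset) simp
  have "(\<Sum>(p', q')\<in>S. kron (B_off (x p' q') (y p' q')) (outer (unit_vec r p') (unit_vec r q')) $$ (i * r + p, j * r + q))
      = (\<Sum>u\<in>S. if u = (p, q) then B_off (x p q) (y p q) $$ (i, j) else 0)"
    by (intro sum.cong refl) (auto simp: S_def k carrier_matI split: if_splits)
  also have "\<dots> = (if p = q then 0 else B_off (x p q) (y p q) $$ (i, j))"
    using assms fin by (simp add: S_def)
  finally have o: "(\<Sum>(p', q')\<in>S. kron (B_off (x p' q') (y p' q')) (outer (unit_vec r p') (unit_vec r q')) $$ (i * r + p, j * r + q))
      = (if p = q then 0 else B_off (x p q) (y p q) $$ (i, j))" .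
  show ?thesis
    using lt d o unfolding B_block_def S_def[symmetric]
    by (simp add: msum_def split_def)
qed

lemma linked_refl:
  assumes "orthogonality ZA" "orthogonality ZB" "\<alpha> \<in> bits2"
  shows "linked ZA ZB \<alpha> \<alpha>"
  using assms(3) by (auto simp: bits2_def linked_simps[OF assms(1,2)])

section \<open>The class Delta_1, its common isometry and the coefficients\<close>

context pr_channel
begin

text \<open>This is the set Delta_1. By the table in \<open>linked_simps\<close> it has 0, 2 or 3
  elements, depending on how many of the two parties have bases that agree up to order and
  phases.\<close>

definition \<Delta> :: "(nat \<times> nat) set" where
  "\<Delta> = {\<alpha> \<in> bits2. \<exists>\<beta>\<in>bits2. \<alpha> \<noteq> \<beta> \<and> link \<alpha> \<beta>}"

text \<open>The default value serves the case of an empty \<open>\<Delta>\<close>, where V_out must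
  still be some isometry.\<close>

definition base :: "nat \<times> nat" where
  "base = (if \<Delta> = {} then (0, 0) else SOME \<alpha>. \<alpha> \<in> \<Delta>)"

text \<open>The phases and the order of the supporting vectors of linked inputs may differ, hence all inputs
  in \<open>\<Delta>\<close> are described by the vectors of one of them.\<close>

definition rep :: "nat \<times> nat \<Rightarrow> nat \<times> nat" where
  "rep \<alpha> = (if \<alpha> \<in> \<Delta> then base else \<alpha>)"

lemma \<Delta>_bits2: "\<Delta> \<subseteq> bits2"
  by (auto simp: \<Delta>_def)

lemma base_\<Delta>: "\<Delta> \<noteq> {} \<Longrightarrow> base \<in> \<Delta>"
  by (simp add: base_def some_in_eq)

lemma base_bits2: "base \<in> bits2"
  using base_\<Delta> \<Delta>_bits2 by (cases "\<Delta> = {}") (auto simp: base_def bits2_def)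

lemma rep_bits2: "\<alpha> \<in> bits2 \<Longrightarrow> rep \<alpha> \<in> bits2"
  by (simp add: rep_def base_bits2)

lemma link_rep:
  assumes "\<alpha> \<in> bits2"
  shows "link \<alpha> (rep \<alpha>)"
proof (cases "\<alpha> \<in> \<Delta>")
  case True
  then have "base \<in> \<Delta>" using base_\<Delta> by auto
  with True obtain \<alpha>' \<beta>' where "\<alpha>' \<in> bits2" "\<alpha> \<noteq> \<alpha>'" "link \<alpha> \<alpha>'" "\<beta>' \<in> bits2" "base \<noteq> \<beta>'" "link base \<beta>'"
    unfolding \<Delta>_def by blast
  then have "link \<alpha> base"
    using linked_linked[OF orthogonality_a orthogonality_b assms base_bits2] by blast
  with True show ?thesis by (simp add: rep_def)
next
  case False
  then show ?thesis
    using linked_refl[OF orthogonality_a orthogonality_b assms] by (simp add: rep_def)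
qed

lemma rep_supp_vec:
  assumes "\<alpha> \<in> bits2"
  obtains p :: "nat \<Rightarrow> nat" and c where "p = id \<or> p = (\<lambda>i. 1 - i)" "\<And>i. i < 2 \<Longrightarrow> c i * cnj (c i) = 1"
    "\<And>i. i < 2 \<Longrightarrow> supp_vec (rep \<alpha>) i = c i \<cdot>\<^sub>v supp_vec \<alpha> (p i)"
  using link_supp_vec[OF assms rep_bits2[OF assms] link_rep[OF assms]] by blast

lemma perm_less_2: "p = id \<or> p = (\<lambda>i. 1 - i) \<Longrightarrow> i < 2 \<Longrightarrow> p i < (2 :: nat)"
  by auto

text \<open>Each phase occurs together with its conjugate and cancels; the change of order merely
  permutes the terms of the sum.\<close>

lemma block_rep_index:
  assumes \<alpha>: "\<alpha> \<in> bits2" and \<beta>: "\<beta> \<in> bits2" and st: "s < 4" "t < 4"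
  shows "block \<alpha> \<beta> $$ (s, t) =
    (\<Sum>i<2. \<Sum>j<2. supp_vec (rep \<alpha>) i $ s * sesq (block \<alpha> \<beta>) (supp_vec (rep \<alpha>) i) (supp_vec (rep \<beta>) j) * cnj (supp_vec (rep \<beta>) j $ t))"
proof -
  obtain p :: "nat \<Rightarrow> nat" and c where p: "p = id \<or> p = (\<lambda>i. 1 - i)" and c: "\<And>i. i < 2 \<Longrightarrow> c i * cnj (c i) = 1"
    and pc: "\<And>i. i < 2 \<Longrightarrow> supp_vec (rep \<alpha>) i = c i \<cdot>\<^sub>v supp_vec \<alpha> (p i)"
    using rep_supp_vec[OF \<alpha>] by blast
  obtain q :: "nat \<Rightarrow> nat" and d where q: "q = id \<or> q = (\<lambda>i. 1 - i)" and d: "\<And>i. i < 2 \<Longrightarrow> d i * cnj (d i) = 1"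
    and qd: "\<And>i. i < 2 \<Longrightarrow> supp_vec (rep \<beta>) i = d i \<cdot>\<^sub>v supp_vec \<beta> (q i)"
    using rep_supp_vec[OF \<beta>] by blast
  define X where "X i j = supp_vec \<alpha> i $ s * sesq (block \<alpha> \<beta>) (supp_vec \<alpha> i) (supp_vec \<beta> j) * cnj (supp_vec \<beta> j $ t)" for i j
  have "supp_vec (rep \<alpha>) i $ s * sesq (block \<alpha> \<beta>) (supp_vec (rep \<alpha>) i) (supp_vec (rep \<beta>) j) * cnj (supp_vec (rep \<beta>) j $ t) = X (p i) (q j)"
    if ij: "i < 2" "j < 2" for i j
  proof -
    have "supp_vec (rep \<alpha>) i $ s * sesq (block \<alpha> \<beta>) (supp_vec (rep \<alpha>) i) (supp_vec (rep \<beta>) j) * cnj (supp_vec (rep \<beta>) j $ t)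
        = (c i * cnj (c i)) * (d j * cnj (d j)) * X (p i) (q j)"
      using ij st perm_less_2[OF p ij(1)] perm_less_2[OF q ij(2)]
      by (simp add: pc qd sesq_smult X_def)
    then show ?thesis using c[OF ij(1)] d[OF ij(2)] by simp
  qed
  then have "(\<Sum>i<2. \<Sum>j<2. supp_vec (rep \<alpha>) i $ s * sesq (block \<alpha> \<beta>) (supp_vec (rep \<alpha>) i) (supp_vec (rep \<beta>) j) * cnj (supp_vec (rep \<beta>) j $ t))
      = (\<Sum>i<2. \<Sum>j<2. X (p i) (q j))"
    by (intro sum.cong refl) auto
  also have "\<dots> = (\<Sum>i<2. \<Sum>j<2. X i j)"
    using p q by (auto simp: sum_lessThan_2)
  also have "\<dots> = block \<alpha> \<beta> $$ (s, t)"
    by (simp add: X_def block_supp_vec[OF \<alpha> \<beta> st])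
  finally show ?thesis ..
qed

lemma block_rep_diag:
  assumes \<alpha>: "\<alpha> \<in> bits2" and "i < 2"
  shows "sesq (block \<alpha> \<alpha>) (supp_vec (rep \<alpha>) i) (supp_vec (rep \<alpha>) i) = 1 / 2"
proof -
  obtain p :: "nat \<Rightarrow> nat" and c where p: "p = id \<or> p = (\<lambda>i. 1 - i)" and c: "\<And>i. i < 2 \<Longrightarrow> c i * cnj (c i) = 1"
    and pc: "\<And>i. i < 2 \<Longrightarrow> supp_vec (rep \<alpha>) i = c i \<cdot>\<^sub>v supp_vec \<alpha> (p i)"
    using rep_supp_vec[OF \<alpha>] by blast
  have "sesq (block \<alpha> \<alpha>) (supp_vec (rep \<alpha>) i) (supp_vec (rep \<alpha>) i) = (c i * cnj (c i)) * sesq (block \<alpha> \<alpha>) (supp_vec \<alpha> (p i)) (supp_vec \<alpha> (p i))"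
    using assms by (simp add: pc sesq_smult)
  also have "\<dots> = 1 / 2"
    using c[OF assms(2)] block_supp_vec_diag[OF \<alpha> perm_less_2[OF p assms(2)]] by simp
  finally show ?thesis .
qed

text \<open>A nonzero element would link the two distinct inputs, and by symmetry of the link both
  would lie in \<open>\<Delta>\<close>.\<close>

lemma block_zero:
  assumes "\<alpha> \<in> bits2" "\<beta> \<in> bits2" "\<alpha> \<noteq> \<beta>" "\<not> (\<alpha> \<in> \<Delta> \<and> \<beta> \<in> \<Delta>)" and st: "s < 4" "t < 4"
  shows "block \<alpha> \<beta> $$ (s, t) = 0"
proof -
  have "\<not> link \<alpha> \<beta>"
  proof
    assume "link \<alpha> \<beta>"
    moreover from this have "link \<beta> \<alpha>"
      using linked_sym[OF orthogonality_a orthogonality_b assms(1,2)] by simp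
    ultimately have "\<alpha> \<in> \<Delta>" "\<beta> \<in> \<Delta>"
      using assms(1-3) by (auto simp: \<Delta>_def)
    with assms(4) show False by simp
  qed
  then have "sesq (block \<alpha> \<beta>) (supp_vec \<alpha> i) (supp_vec \<beta> j) = 0" if "i < 2" "j < 2" for i j
    using block_offdiag(1)[OF assms(1-3) that] by blast
  then show ?thesis
    by (simp add: block_supp_vec[OF assms(1,2) st])
qed

text \<open>The same base vector is parallel to a supporting vector of each input, so these two are
  not orthogonal, whereas a nonzero element between them would require it. This is where the zero
  diagonal of \<open>B_off\<close> comes from.\<close>

lemma block_base_offdiag:
  assumes "\<alpha> \<in> \<Delta>" "\<beta> \<in> \<Delta>" "\<alpha> \<noteq> \<beta>" and i: "i < 2"
  shows "sesq (block \<alpha> \<beta>) (supp_vec base i) (supp_vec base i) = 0"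
proof -
  have \<alpha>: "\<alpha> \<in> bits2" and \<beta>: "\<beta> \<in> bits2" and rep: "rep \<alpha> = base" "rep \<beta> = base"
    using assms by (auto simp: rep_def \<Delta>_def)
  obtain p :: "nat \<Rightarrow> nat" and c where p: "p = id \<or> p = (\<lambda>i. 1 - i)" and c: "\<And>i. i < 2 \<Longrightarrow> c i * cnj (c i) = 1"
    and pc: "\<And>i. i < 2 \<Longrightarrow> supp_vec base i = c i \<cdot>\<^sub>v supp_vec \<alpha> (p i)"
    using rep_supp_vec[OF \<alpha>] unfolding rep by blast
  obtain q :: "nat \<Rightarrow> nat" and d where q: "q = id \<or> q = (\<lambda>i. 1 - i)" and d: "\<And>i. i < 2 \<Longrightarrow> d i * cnj (d i) = 1"
    and qd: "\<And>i. i < 2 \<Longrightarrow> supp_vec base i = d i \<cdot>\<^sub>v supp_vec \<beta> (q i)"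
    using rep_supp_vec[OF \<beta>] unfolding rep by blast
  note pq = perm_less_2[OF p i] perm_less_2[OF q i]
  have "supp_vec base i \<bullet>c supp_vec base i = (c i \<cdot>\<^sub>v supp_vec \<alpha> (p i)) \<bullet>c (d i \<cdot>\<^sub>v supp_vec \<beta> (q i))"
    using pc[OF i] qd[OF i] by simp
  also have "\<dots> = c i * cnj (d i) * (supp_vec \<alpha> (p i) \<bullet>c supp_vec \<beta> (q i))"
    using pq by (simp add: cscalar_prod_conv_sum[where n = 4] sum_distrib_left mult_ac)
  finally have "supp_vec \<alpha> (p i) \<bullet>c supp_vec \<beta> (q i) \<noteq> 0"
    using supp_vec_orthonormal[OF i i, of base] by auto
  then have z: "sesq (block \<alpha> \<beta>) (supp_vec \<alpha> (p i)) (supp_vec \<beta> (q i)) = 0"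
    using block_offdiag(2)[OF \<alpha> \<beta> assms(3) pq] by blast
  have "sesq (block \<alpha> \<beta>) (supp_vec base i) (supp_vec base i) = sesq (block \<alpha> \<beta>) (c i \<cdot>\<^sub>v supp_vec \<alpha> (p i)) (d i \<cdot>\<^sub>v supp_vec \<beta> (q i))"
    using pc[OF i] qd[OF i] by simp
  then show ?thesis
    by (simp add: sesq_smult z)
qed

definition U :: "nat \<times> nat \<Rightarrow> complex mat" where
  "U \<alpha> = mat 4 2 (\<lambda>(s, i). supp_vec (rep \<alpha>) i $ s)"

text \<open>The factor 2 compensates for the 1/2 in front of the blocks, which normalizes the
  diagonal entries to 1.\<close>

definition zeta :: "nat \<times> nat \<Rightarrow> complex" where
  "zeta \<alpha> = 2 * sesq (block \<alpha> \<alpha>) (supp_vec (rep \<alpha>) 0) (supp_vec (rep \<alpha>) 1)"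

lemma isometry_U: "isometry_mat 2 4 (U \<alpha>)"
proof -
  have "(mat_adjoint (U \<alpha>) * U \<alpha>) $$ (i, j) = supp_vec (rep \<alpha>) j \<bullet>c supp_vec (rep \<alpha>) i" if "i < 2" "j < 2" for i j
    using that by (simp add: U_def scalar_prod_def atLeast0LessThan mult.commute)
  then have "mat_adjoint (U \<alpha>) * U \<alpha> = 1\<^sub>m 2"
    by (intro eq_matI) (auto simp: U_def supp_vec_orthonormal)
  then show ?thesis
    by (simp add: isometry_mat_def U_def)
qed

lemma block_diag_conj:
  assumes "\<alpha> \<in> bits2" "s < 4" "t < 4"
  shows "block \<alpha> \<alpha> $$ (s, t) = 1 / 2 * (\<Sum>i<2. \<Sum>j<2. U \<alpha> $$ (s, i) * B_diag (zeta \<alpha>) $$ (i, j) * cnj (U \<alpha> $$ (t, j)))"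
proof -
  have d: "sesq (block \<alpha> \<alpha>) (supp_vec (rep \<alpha>) 0) (supp_vec (rep \<alpha>) 0) = 1 / 2"
      "sesq (block \<alpha> \<alpha>) (supp_vec (rep \<alpha>) (Suc 0)) (supp_vec (rep \<alpha>) (Suc 0)) = 1 / 2"
    by (rule block_rep_diag[OF assms(1)]; simp)+
  have "sesq (block \<alpha> \<alpha>) (supp_vec (rep \<alpha>) (Suc 0)) (supp_vec (rep \<alpha>) 0)
      = cnj (sesq (block \<alpha> \<alpha>) (supp_vec (rep \<alpha>) 0) (supp_vec (rep \<alpha>) (Suc 0)))"
    by (rule cauchy_schwarz(1)) (simp_all add: supp_vec_carrier)
  then show ?thesis
    using assms
    by (simp add: block_rep_index sum_lessThan_2 B_diag_index zeta_def U_def d algebra_simps)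
qed

text \<open>Cauchy-Schwarz inside a single block, whose diagonal elements are both 1/2.\<close>

lemma cmod_zeta_le_1:
  assumes "\<alpha> \<in> bits2"
  shows "cmod (zeta \<alpha>) \<le> 1"
proof -
  have d: "sesq (block \<alpha> \<alpha>) (supp_vec (rep \<alpha>) 0) (supp_vec (rep \<alpha>) 0) = 1 / 2"
      "sesq (block \<alpha> \<alpha>) (supp_vec (rep \<alpha>) 1) (supp_vec (rep \<alpha>) 1) = 1 / 2"
    by (rule block_rep_diag[OF assms]; simp)+
  have c: "supp_vec (rep \<alpha>) 0 \<in> carrier_vec 4" "supp_vec (rep \<alpha>) 1 \<in> carrier_vec 4"
    by (rule supp_vec_carrier; simp)+
  have "(cmod (zeta \<alpha> / 2))\<^sup>2 \<le> (1 / 2)\<^sup>2"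
    using cauchy_schwarz(2)[OF c, of \<alpha> \<alpha>] unfolding d
    by (simp add: zeta_def power2_eq_square)
  then have "cmod (zeta \<alpha> / 2) \<le> 1 / 2"
    by (rule power2_le_imp_le) simp
  then show ?thesis
    by (simp add: norm_divide)
qed

lemma block_off_conj:
  assumes "\<alpha> \<in> \<Delta>" "\<beta> \<in> \<Delta>" "\<alpha> \<noteq> \<beta>" "s < 4" "t < 4"
  shows "block \<alpha> \<beta> $$ (s, t) = 1 / 2 * (\<Sum>i<2. \<Sum>j<2. U base $$ (s, i) *
    B_off (2 * sesq (block \<alpha> \<beta>) (supp_vec base 0) (supp_vec base 1)) (2 * sesq (block \<alpha> \<beta>) (supp_vec base 1) (supp_vec base 0)) $$ (i, j)
    * cnj (U base $$ (t, j)))"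
proof -
  have "\<alpha> \<in> bits2" "\<beta> \<in> bits2" "rep \<alpha> = base" "rep \<beta> = base" "rep base = base"
    using assms base_\<Delta> by (auto simp: rep_def \<Delta>_def)
  then show ?thesis
    using assms block_base_offdiag[OF assms(1-3), of 0] block_base_offdiag[OF assms(1-3), of 1]
    by (simp add: block_rep_index sum_lessThan_2 B_off_index U_def algebra_simps)
qed

lemma isometry_ket2:
  assumes "bij_betw e {..<r} S" "S \<subseteq> bits2"
  shows "isometry_mat r 4 (mat 4 r (\<lambda>(n, p). ket2 (e p) $ n))"
proof -
  have e: "e p \<in> bits2" if "p < r" for p
    using assms that by (auto simp: bij_betw_def)
  have inner: "ket2 \<alpha> \<bullet>c ket2 \<beta> = (if \<alpha> = \<beta> then 1 else 0)" if \<alpha>\<beta>: "\<alpha> \<in> bits2" "\<beta> \<in> bits2" for \<alpha> \<beta>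
  proof -
    obtain k m k' m' where kl: "\<alpha> = (k, m)" "\<beta> = (k', m')" "k < 2" "m < 2" "k' < 2" "m' < 2"
      using \<alpha>\<beta> by (cases \<alpha>, cases \<beta>) (auto simp: mem_bits2_iff)
    then have "2 * k + m < 4" "2 * k' + m' < 4" "2 * k + m = 2 * k' + m' \<longleftrightarrow> \<alpha> = \<beta>"
      by (simp_all, presburger)
    then show ?thesis
      using orthonormal_basis_unit_vec[of 4] kl by (simp add: ket2_conv_unit_vec orthonormal_basis_def)
  qed
  let ?V = "mat 4 r (\<lambda>(n, p). ket2 (e p) $ n)"
  have "(mat_adjoint ?V * ?V) $$ (p, q) = ket2 (e q) \<bullet>c ket2 (e p)" if "p < r" "q < r" for p q
    using that by (simp add: scalar_prod_def atLeast0LessThan mult.commute)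
  moreover have "e p = e q \<longleftrightarrow> p = q" if "p < r" "q < r" for p q
    using assms(1) that by (auto simp: bij_betw_def inj_on_def)
  ultimately have "mat_adjoint ?V * ?V = 1\<^sub>m r"
    by (intro eq_matI) (auto simp: inner e)
  then show ?thesis
    by (simp add: isometry_mat_def)
qed

lemma sum_bits2_index:
  assumes "S \<subseteq> bits2" "k < 2" "m < 2" "k' < 2" "m' < 2" and carrier: "\<And>\<alpha>. \<alpha> \<in> S \<Longrightarrow> X \<alpha> \<in> carrier_mat 4 4"
    and "s < 4" "t < 4"
  shows "(\<Sum>\<alpha>\<in>S. kron (X \<alpha>) (outer (ket2 \<alpha>) (ket2 \<alpha>)) $$ (s * 4 + (2 * k + m), t * 4 + (2 * k' + m'))) =
    (if (k, m) = (k', m') \<and> (k, m) \<in> S then X (k, m) $$ (s, t) else 0)"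
proof -
  have "(\<Sum>\<alpha>\<in>S. kron (X \<alpha>) (outer (ket2 \<alpha>) (ket2 \<alpha>)) $$ (s * 4 + (2 * k + m), t * 4 + (2 * k' + m')))
      = (\<Sum>\<alpha>\<in>S. if \<alpha> = (k, m) then (if (k, m) = (k', m') then X (k, m) $$ (s, t) else 0) else 0)"
  proof (rule sum.cong[OF refl])
    fix \<alpha> assume \<alpha>: "\<alpha> \<in> S"
    then have "kron (X \<alpha>) (outer (ket2 \<alpha>) (ket2 \<alpha>)) $$ (s * 4 + (2 * k + m), t * 4 + (2 * k' + m'))
        = X \<alpha> $$ (s, t) * outer (ket2 \<alpha>) (ket2 \<alpha>) $$ (2 * k + m, 2 * k' + m')"
      using assms carrier_matD[OF carrier[OF \<alpha>]] by (intro kron_index) auto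
    then show "kron (X \<alpha>) (outer (ket2 \<alpha>) (ket2 \<alpha>)) $$ (s * 4 + (2 * k + m), t * 4 + (2 * k' + m'))
        = (if \<alpha> = (k, m) then (if (k, m) = (k', m') then X (k, m) $$ (s, t) else 0) else 0)"
      using assms(1-5,7,8) subsetD[OF assms(1) \<alpha>] by (auto simp: ket2_index split: if_splits)
  qed
  also have "\<dots> = (if (k, m) = (k', m') \<and> (k, m) \<in> S then X (k, m) $$ (s, t) else 0)"
    using finite_subset[OF assms(1)] by auto
  finally show ?thesis .
qed

text \<open>The first summand reproduces the blocks with both inputs in \<open>\<Delta>\<close>, the
  second the diagonal blocks outside; all others vanish by \<open>block_zero\<close>.\<close>

lemma choi_decomposition:
  assumes e: "bij_betw e {..<r} \<Delta>"
  defines "V \<equiv> mat 4 r (\<lambda>(n, p). ket2 (e p) $ n)"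
    and "x \<equiv> \<lambda>p q. 2 * sesq (block (e p) (e q)) (supp_vec base 0) (supp_vec base 1)"
    and "y \<equiv> \<lambda>p q. 2 * sesq (block (e p) (e q)) (supp_vec base 1) (supp_vec base 0)"
  shows "choi \<Phi> = kron (U base) V * B_block r (zeta \<circ> e) x y * kron (mat_adjoint (U base)) (mat_adjoint V) +
    (1 / 2) \<cdot>\<^sub>m msum 16 16
      (\<lambda>\<alpha>. kron (U \<alpha> * B_diag (zeta \<alpha>) * mat_adjoint (U \<alpha>)) (outer (ket2 \<alpha>) (ket2 \<alpha>))) (bits2 - \<Delta>)"
    (is "_ = ?K + ?D")
proof (rule eq_matI)
  have U: "U \<alpha> \<in> carrier_mat 4 2" for \<alpha> by (simp add: U_def)
  have V: "V \<in> carrier_mat 4 r" by (simp add: V_def)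
  show dim: "dim_row (choi \<Phi>) = dim_row (?K + ?D)" "dim_col (choi \<Phi>) = dim_col (?K + ?D)"
    by (simp_all add: choi_def msum_def)
  fix u v assume uv: "u < dim_row (?K + ?D)" "v < dim_col (?K + ?D)"
  have uv16: "u < 16" "v < 16" using uv by (simp_all add: msum_def)
  obtain s k m where u: "u = s * 4 + (2 * k + m)" "s < 4" "k < 2" "m < 2"
    using four_digits[of u 4] uv16(1) by auto
  obtain t k' m' where v: "v = t * 4 + (2 * k' + m')" "t < 4" "k' < 2" "m' < 2"
    using four_digits[of v 4] uv16(2) by auto
  let ?\<alpha> = "(k, m)" and ?\<beta> = "(k', m')"
  have bits: "?\<alpha> \<in> bits2" "?\<beta> \<in> bits2" using u v by (simp_all add: mem_bits2_iff)
  have lt: "2 * k + m < 4" "2 * k' + m' < 4" using u v by simp_all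
  have e_mem: "e p \<in> \<Delta>" if "p < r" for p
    using e that by (auto simp: bij_betw_def)
  have e_bits: "e p \<in> bits2" if "p < r" for p
    using e_mem[OF that] \<Delta>_bits2 by auto
  have "choi \<Phi> $$ (u, v) = block ?\<alpha> ?\<beta> $$ (s, t)"
    unfolding u(1) v(1) using u v by (intro choi_index channel_carrier)
  define T where "T p q = (\<Sum>i<2. \<Sum>j<2. U base $$ (s, i) * B_block r (zeta \<circ> e) x y $$ (i * r + p, j * r + q) * cnj (U base $$ (t, j)))" for p q
  have T: "T p q = block (e p) (e q) $$ (s, t)" if pq: "p < r" "q < r" for p q
  proof (cases "p = q")
    case True
    have "U (e p) = U base"
      using e_mem[OF pq(1)] base_\<Delta> by (auto simp: U_def rep_def)
    then show ?thesis
      unfolding True[symmetric] block_diag_conj[OF e_bits[OF pq(1)] u(2) v(2)]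
      using pq True by (simp add: T_def B_block_index sum_distrib_left mult_ac)
  next
    case False
    then have "e p \<noteq> e q"
      using e pq by (auto simp: bij_betw_def inj_on_def)
    from block_off_conj[OF e_mem[OF pq(1)] e_mem[OF pq(2)] this u(2) v(2)] show ?thesis
      using pq False by (simp add: T_def B_block_index x_def y_def sum_distrib_left mult_ac)
  qed
  \<comment> \<open>The enumeration \<open>e\<close> meets each element of \<open>\<Delta>\<close>
    once, so the entries of \<open>V\<close> act as membership indicators.\<close>
  have count: "(\<Sum>p<r. if e p = \<gamma> then 1 else 0) = (if \<gamma> \<in> \<Delta> then 1 else (0 :: complex))" for \<gamma>
    using sum.reindex_bij_betw[OF e, of "\<lambda>\<alpha>. if \<alpha> = \<gamma> then 1 else (0 :: complex)"]
      finite_subset[OF \<Delta>_bits2] by simp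
  have "?K $$ (u, v) = (\<Sum>p<r. \<Sum>q<r. V $$ (2 * k + m, p) * cnj (V $$ (2 * k' + m', q)) * T p q)"
    unfolding u(1) v(1) T_def
    by (rule kron_conj_index[OF U V B_block_carrier u(2) v(2) lt])
  also have "\<dots> = (\<Sum>p<r. \<Sum>q<r. (if e p = ?\<alpha> then 1 else 0) * (if e q = ?\<beta> then 1 else 0) * block ?\<alpha> ?\<beta> $$ (s, t))"
    using lt u v by (intro sum.cong refl) (auto simp: V_def T ket2_index e_bits)
  also have "\<dots> = (\<Sum>p<r. if e p = ?\<alpha> then 1 else 0) * (\<Sum>q<r. if e q = ?\<beta> then 1 else 0) * block ?\<alpha> ?\<beta> $$ (s, t)"
    by (subst sum_product) (simp only: sum_distrib_right)
  also have "\<dots> = (if ?\<alpha> \<in> \<Delta> then 1 else 0) * (if ?\<beta> \<in> \<Delta> then 1 else 0) * block ?\<alpha> ?\<beta> $$ (s, t)"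
    by (simp only: count)
  finally have K: "?K $$ (u, v) = (if ?\<alpha> \<in> \<Delta> then 1 else 0) * (if ?\<beta> \<in> \<Delta> then 1 else 0) * block ?\<alpha> ?\<beta> $$ (s, t)" .
  have "?D $$ (u, v) = 1 / 2 * (\<Sum>\<alpha>\<in>bits2 - \<Delta>. kron (U \<alpha> * B_diag (zeta \<alpha>) * mat_adjoint (U \<alpha>)) (outer (ket2 \<alpha>) (ket2 \<alpha>)) $$ (u, v))"
    using uv16 by (simp add: msum_def)
  also have "\<dots> = 1 / 2 * (if ?\<alpha> = ?\<beta> \<and> ?\<alpha> \<in> bits2 - \<Delta> then (U ?\<alpha> * B_diag (zeta ?\<alpha>) * mat_adjoint (U ?\<alpha>)) $$ (s, t) else 0)"
    unfolding u(1) v(1) using u v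
    by (subst sum_bits2_index) (auto simp: U_def intro!: carrier_matI)
  also have "\<dots> = (if ?\<alpha> = ?\<beta> \<and> ?\<alpha> \<notin> \<Delta> then block ?\<alpha> ?\<beta> $$ (s, t) else 0)"
    using bits block_diag_conj[OF bits(1) u(2) v(2)] conj_index[OF U B_diag_carrier U u(2) v(2), of ?\<alpha> "zeta ?\<alpha>" ?\<alpha>]
    by auto
  finally have D: "?D $$ (u, v) = (if ?\<alpha> = ?\<beta> \<and> ?\<alpha> \<notin> \<Delta> then block ?\<alpha> ?\<beta> $$ (s, t) else 0)" .
  have "block ?\<alpha> ?\<beta> $$ (s, t) = ?K $$ (u, v) + ?D $$ (u, v)"
    unfolding K D using block_zero[OF bits _ _ u(2) v(2)] by auto
  moreover have "(?K + ?D) $$ (u, v) = ?K $$ (u, v) + ?D $$ (u, v)"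
    using uv16 by (intro index_add_mat) (simp_all add: msum_def)
  ultimately show "choi \<Phi> $$ (u, v) = (?K + ?D) $$ (u, v)"
    using \<open>choi \<Phi> $$ (u, v) = block ?\<alpha> ?\<beta> $$ (s, t)\<close> by simp
qed

end

theorem proposition4:
  fixes \<Phi> :: "complex mat \<Rightarrow> complex mat" and \<eta>\<^sub>A \<eta>\<^sub>B :: "nat \<Rightarrow> complex vec"
  assumes "orthonormal_basis 2 \<eta>\<^sub>A" and "orthonormal_basis 2 \<eta>\<^sub>B"
    and "PR_channel \<eta>\<^sub>A \<eta>\<^sub>B \<Phi>"
  shows "\<exists>(U :: nat \<times> nat \<Rightarrow> complex mat) \<Delta>\<^sub>0 \<Delta>\<^sub>1 V_out V_in
           (zeta :: nat \<times> nat \<Rightarrow> complex) (a :: nat \<Rightarrow> nat \<times> nat)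
           (z :: nat \<Rightarrow> complex) (x :: nat \<Rightarrow> nat \<Rightarrow> complex) (y :: nat \<Rightarrow> nat \<Rightarrow> complex) r.
      (\<forall>\<alpha>\<in>bits2. isometry_mat 2 4 (U \<alpha>)) \<and>
      \<Delta>\<^sub>0 \<union> \<Delta>\<^sub>1 = bits2 \<and> \<Delta>\<^sub>0 \<inter> \<Delta>\<^sub>1 = {} \<and>
      isometry_mat 2 4 V_out \<and> (\<forall>\<alpha>\<in>\<Delta>\<^sub>1. U \<alpha> = V_out) \<and>
      (\<forall>\<alpha>\<in>\<Delta>\<^sub>0. cmod (zeta \<alpha>) \<le> 1) \<and>
      r = card \<Delta>\<^sub>1 \<and> bij_betw a {..<r} \<Delta>\<^sub>1 \<and>
      isometry_mat r 4 V_in \<and> (\<forall>p<r. V_in *\<^sub>v unit_vec r p = ket2 (a p)) \<and>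
      choi \<Phi> =
        kron V_out V_in * B_block r z x y * kron (mat_adjoint V_out) (mat_adjoint V_in) +
        (1 / 2) \<cdot>\<^sub>m msum 16 16
          (\<lambda>\<alpha>. kron (U \<alpha> * B_diag (zeta \<alpha>) * mat_adjoint (U \<alpha>)) (outer (ket2 \<alpha>) (ket2 \<alpha>))) \<Delta>\<^sub>0"
proof -
  interpret pr_channel \<Phi> \<eta>\<^sub>A \<eta>\<^sub>B
    using assms by unfold_locales
  have fin: "finite \<Delta>"
    using finite_subset[OF \<Delta>_bits2] by simp
  obtain e where e: "bij_betw e {..<card \<Delta>} \<Delta>"
    using ex_bij_betw_nat_finite[OF fin] by (auto simp: lessThan_atLeast0)
  let ?V = "mat 4 (card \<Delta>) (\<lambda>(n, p). ket2 (e p) $ n)"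
  let ?x = "\<lambda>p q. 2 * sesq (block (e p) (e q)) (supp_vec base 0) (supp_vec base 1)"
  let ?y = "\<lambda>p q. 2 * sesq (block (e p) (e q)) (supp_vec base 1) (supp_vec base 0)"
  show ?thesis
  proof (rule exI[of _ U], rule exI[of _ "bits2 - \<Delta>"], rule exI[of _ \<Delta>], rule exI[of _ "U base"],
      rule exI[of _ ?V], rule exI[of _ zeta], rule exI[of _ e], rule exI[of _ "zeta \<circ> e"],
      rule exI[of _ ?x], rule exI[of _ ?y], rule exI[of _ "card \<Delta>"], intro conjI)
    show "\<forall>\<alpha>\<in>bits2. isometry_mat 2 4 (U \<alpha>)" "isometry_mat 2 4 (U base)"
      by (simp_all add: isometry_U)
    show "bits2 - \<Delta> \<union> \<Delta> = bits2"
      using \<Delta>_bits2 by blast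
    show "(bits2 - \<Delta>) \<inter> \<Delta> = {}"
      by blast
    show "\<forall>\<alpha>\<in>\<Delta>. U \<alpha> = U base"
      using base_\<Delta> by (auto simp: U_def rep_def)
    show "\<forall>\<alpha>\<in>bits2 - \<Delta>. cmod (zeta \<alpha>) \<le> 1"
      using cmod_zeta_le_1 by blast
    show "bij_betw e {..<card \<Delta>} \<Delta>"
      by (rule e)
    show "isometry_mat (card \<Delta>) 4 ?V"
      by (rule isometry_ket2[OF e \<Delta>_bits2])
    show "\<forall>p<card \<Delta>. ?V *\<^sub>v unit_vec (card \<Delta>) p = ket2 (e p)"
      by (intro allI impI eq_vecI) simp_all
  qed (rule refl, rule choi_decomposition[OF e])
qed

end
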